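(* Let $G$ be a perfect graph and let $I=I(G)$. Then, for any $t\ge2$, we have $$\dim(I^{(t)}/I^t)=\dim(I^{(2)}/I^2).$$
   Context: A graph on the vertex set $[n]=\{1,\dots,n\}$ always means a simple connected graph. A graph is perfect if neither it nor its complement has an induced odd cycle of length $\ge5$. The edge ideal is $I(G)=(x_ix_j:\{i,j\}\in E(G))\subseteq S=k[x_1,\dots,x_n]$, $k$ an arbitrary field. The $t$-th symbolic power is $I^{(t)}=\bigcap_{\mathfrak p\in\mathrm{Ass}(I)}(I^tS_{\mathfrak p}\cap S)$. By convention the zero module has dimension $-1$. *)

theory Defs
  imports
    "HOL-Algebra.Ideal_Product"
    "HOL-Algebra.QuotRing"
    "HOL-Algebra.Module"
    "HOL-Algebra.Algebraic_Closure_Type"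
    "HOL-Computational_Algebra.Fraction_Field"
    "HOL-Library.Poly_Mapping"
    "HOL-Library.Extended_Real"
begin

section \<open>Graphs\<close>

text \<open>A graph is given by its vertex set and its set of edges; an edge is a two-element set.\<close>

definition simple_graph :: "'v set \<Rightarrow> 'v set set \<Rightarrow> bool" where
  "simple_graph V E \<longleftrightarrow> finite V \<and> E \<subseteq> {{u, v} | u v. u \<in> V \<and> v \<in> V \<and> u \<noteq> v}"

definition connected_graph :: "'v set \<Rightarrow> 'v set set \<Rightarrow> bool" where
  "connected_graph V E \<longleftrightarrow>
     V \<noteq> {} \<and> (\<forall>u\<in>V. \<forall>v\<in>V. (u, v) \<in> {(a, b). {a, b} \<in> E}\<^sup>*)"

definition graph_complement :: "'v set \<Rightarrow> 'v set set \<Rightarrow> 'v set set" where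
  "graph_complement V E = {{u, v} | u v. u \<in> V \<and> v \<in> V \<and> u \<noteq> v \<and> {u, v} \<notin> E}"

text \<open>The list \<open>c\<close> enumerates the vertices of the cycle in cyclic order.\<close>

definition has_induced_cycle :: "'v set \<Rightarrow> 'v set set \<Rightarrow> nat \<Rightarrow> bool" where
  "has_induced_cycle V E m \<longleftrightarrow>
     m \<ge> 3 \<and>
     (\<exists>c. length c = m \<and> distinct c \<and> set c \<subseteq> V \<and>
          (\<forall>i<m. \<forall>j<m. {c ! i, c ! j} \<in> E \<longleftrightarrow> j = Suc i mod m \<or> i = Suc j mod m))"

definition perfect_graph :: "'v set \<Rightarrow> 'v set set \<Rightarrow> bool" where
  "perfect_graph V E \<longleftrightarrow>
     (\<forall>m. odd m \<and> m \<ge> 5 \<longrightarrow>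
        \<not> has_induced_cycle V E m \<and> \<not> has_induced_cycle V (graph_complement V E) m)"


section \<open>Quotient modules, annihilators, associated primes, dimension\<close>

text \<open>
  The \<open>R\<close>-module \<open>I / J\<close> for ideals \<open>J \<subseteq> I\<close> of \<open>R\<close>. Its elements are the additive cosets of \<open>J\<close>
  that lie in \<open>I\<close>. The library's module record extends the ring record, so the fields
  \<open>mult\<close> and \<open>one\<close> have to be filled in, but they play no role for modules.
\<close>

definition quot_module ::
    "('a, 'm) ring_scheme \<Rightarrow> 'a set \<Rightarrow> 'a set \<Rightarrow> ('a, 'a set) module" where
  "quot_module R I J =
     \<lparr>carrier = {J +>\<^bsub>R\<^esub> x | x. x \<in> I}, monoid.mult = rcoset_mult R J, monoid.one = J +>\<^bsub>R\<^esub> \<one>\<^bsub>R\<^esub>,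
      zero = J, add = set_add R, module.smult = (\<lambda>r C. \<Union>x\<in>C. J +>\<^bsub>R\<^esub> (r \<otimes>\<^bsub>R\<^esub> x))\<rparr>"

definition annihilator ::
    "('a, 'm) ring_scheme \<Rightarrow> ('a, 'b, 'n) module_scheme \<Rightarrow> 'a set" where
  "annihilator R M = {r \<in> carrier R. \<forall>x\<in>carrier M. r \<odot>\<^bsub>M\<^esub> x = \<zero>\<^bsub>M\<^esub>}"

definition associated_primes ::
    "('a, 'm) ring_scheme \<Rightarrow> ('a, 'b, 'n) module_scheme \<Rightarrow> 'a set set" where
  "associated_primes R M =
     {P. primeideal P R \<and> (\<exists>x\<in>carrier M. P = {r \<in> carrier R. r \<odot>\<^bsub>M\<^esub> x = \<zero>\<^bsub>M\<^esub>})}"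

definition krull_dim :: "('a, 'm) ring_scheme \<Rightarrow> ereal" where
  "krull_dim R =
     Sup {ereal (real m) | m. \<exists>P :: nat \<Rightarrow> 'a set.
            (\<forall>i\<le>m. primeideal (P i) R) \<and> (\<forall>i<m. P i \<subset> P (Suc i))}"

text \<open>
  \<open>dim M = dim (R / Ann M)\<close>, where the zero module has dimension \<open>-1\<close> by convention.
\<close>

definition module_dim :: "('a, 'm) ring_scheme \<Rightarrow> ('a, 'b, 'n) module_scheme \<Rightarrow> ereal" where
  "module_dim R M =
     (if carrier M = {\<zero>\<^bsub>M\<^esub>} then -1 else krull_dim (R Quot annihilator R M))"


section \<open>Polynomial rings, edge ideals, symbolic powers\<close>

text \<open>
  A monomial is a finitely supported exponent function, a polynomial is a finitely supported
  function from monomials to coefficients. \<open>mpoly_ring n\<close> is the ring \<open>k[x\<^sub>1, \<dots>, x\<^sub>n]\<close>, where \<open>k\<close> is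
  the type of coefficients.
\<close>

type_synonym 'k mpoly = "(nat \<Rightarrow>\<^sub>0 nat) \<Rightarrow>\<^sub>0 'k"

definition indet :: "nat \<Rightarrow> 'k::comm_ring_1 mpoly" where
  "indet i = Poly_Mapping.single (Poly_Mapping.single i 1) 1"

definition mpoly_ring :: "nat \<Rightarrow> 'k::comm_ring_1 mpoly ring" where
  "mpoly_ring n =
     ring_of_type_algebra\<lparr>carrier := {p. \<forall>m\<in>Poly_Mapping.keys p. Poly_Mapping.keys m \<subseteq> {1..n}}\<rparr>"

definition edge_ideal :: "nat \<Rightarrow> nat set set \<Rightarrow> 'k::comm_ring_1 mpoly set" where
  "edge_ideal n E = Idl\<^bsub>mpoly_ring n\<^esub> {indet i * indet j | i j. {i, j} \<in> E}"

definition ideal_power :: "('a, 'm) ring_scheme \<Rightarrow> 'a set \<Rightarrow> nat \<Rightarrow> 'a set" where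
  "ideal_power R I t = I [^]\<^bsub>ideals_set R\<^esub> t"

text \<open>
  The localization of \<open>k[x\<^sub>1, \<dots>, x\<^sub>n]\<close> at a prime ideal \<open>P\<close>, as a subring of a field of fractions;
  \<open>f \<mapsto> Fract f 1\<close> is the inclusion of the polynomial ring.
\<close>

definition localization :: "nat \<Rightarrow> 'k::field mpoly set \<Rightarrow> 'k mpoly fract ring" where
  "localization n P =
     ring_of_type_algebra
       \<lparr>carrier := {Fract f s | f s. f \<in> carrier (mpoly_ring n) \<and> s \<in> carrier (mpoly_ring n) - P}\<rparr>"

definition extension :: "nat \<Rightarrow> 'k::field mpoly set \<Rightarrow> 'k mpoly set \<Rightarrow> 'k mpoly fract set" where
  "extension n P J = Idl\<^bsub>localization n P\<^esub> ((\<lambda>f. Fract f 1) ` J)"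

text \<open>
  The associated primes of the ideal \<open>I\<close> are those of the module \<open>S / I\<close>.
\<close>

definition symbolic_power :: "nat \<Rightarrow> 'k::field mpoly set \<Rightarrow> nat \<Rightarrow> 'k mpoly set" where
  "symbolic_power n I t =
     {f \<in> carrier (mpoly_ring n).
        \<forall>P \<in> associated_primes (mpoly_ring n) (quot_module (mpoly_ring n) (carrier (mpoly_ring n)) I).
          Fract f 1 \<in> extension n P (ideal_power (mpoly_ring n) I t)}"

end

theory Submission
  imports Defs
begin

text \<open>
  Let \<open>t \<ge> 2\<close>. The point is that the set of primes containing the annihilator of
  \<open>I\<^sup>(\<^sup>t\<^sup>) / I\<^sup>t\<close> can be described in terms of the graph alone: a prime \<open>P\<close>
  belongs to it if and only if \<open>P\<close> contains a variable of every edge and there is a triangle of which all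
  vertices and all neighbours have their variables in \<open>P\<close> (lemma \<open>prime_contains_annihilator_iff\<close>).
  The dimension depends only on this set of primes (\<open>krull_dim_quot_cong\<close>) and hence not on \<open>t\<close>. If
  \<open>G\<close> has no triangle, both modules are zero.

  Suppose that \<open>P\<close> contains the annihilator, and let \<open>W\<close> be the set of the vertices whose variables
  are not in \<open>P\<close>. Since the annihilator contains \<open>I\<^sup>t\<close>, the set \<open>W\<close> is
  independent. Suppose, for contradiction, that every triangle contains a vertex of \<open>W\<close> or a neighbour of one.
  Then the graph that remains after deleting \<open>W\<close> and its neighbours is triangle-free, and by perfectness it has
  no induced odd cycle of length at least \<open>5\<close> either, so it is bipartite
  (\<open>bipartite_if_no_induced_odd_cycle\<close>). For bipartite graphs the weighted form of Koenig's theorem holds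
  (\<open>bipartite_packing\<close>): a monomial whose weight on every vertex cover is at least \<open>t\<close> is divisible
  by a product of \<open>t\<close> edges. The monomials of elements of \<open>I\<^sup>(\<^sup>t\<^sup>)\<close> do have this
  weight on every vertex cover of \<open>G\<close>, because the primes of the minimal vertex covers are associated to
  \<open>I\<close> (\<open>symbolic_power_weight\<close>). It follows that the \<open>t\<close>-th power of the product of
  the variables in \<open>W\<close> multiplies \<open>I\<^sup>(\<^sup>t\<^sup>)\<close> into \<open>I\<^sup>t\<close>
  (\<open>packs_if_triangles_near_independent_set\<close>). This element of the annihilator is not in \<open>P\<close>, a
  contradiction.

  Conversely, for a triangle \<open>a\<close>, \<open>b\<close>, \<open>c\<close> the monomial \<open>(x\<^sub>a
  x\<^sub>b)\<^sup>t\<^sup>-\<^sup>2 x\<^sub>a x\<^sub>b x\<^sub>c\<close> lies in \<open>I\<^sup>(\<^sup>t\<^sup>)\<close>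
  (\<open>triangle_monomial_symbolic\<close>), but its degree is only \<open>2 t - 1\<close>. If \<open>P\<close> satisfies
  the condition above, an element \<open>f\<close> outside \<open>P\<close> has a monomial \<open>u\<close> without variables
  in \<open>P\<close>. The variables of \<open>u\<close> are pairwise non-adjacent and neither lie in the triangle nor are
  adjacent to it, so multiplying the triangle monomial by \<open>u\<close> provides no further edges and does not reach
  \<open>I\<^sup>t\<close>. Hence \<open>f\<close> does not annihilate the module.
\<close>

abbreviation expo :: "('a \<Rightarrow>\<^sub>0 'b::zero) \<Rightarrow> 'a \<Rightarrow> 'b" where
  "expo \<equiv> Poly_Mapping.lookup"

section \<open>Graphs without odd holes\<close>

lemma closed_walk_split:
  assumes "\<forall>i<m. (f i, f (Suc i)) \<in> R" "i \<le> j" "j \<le> m"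
  shows "(f i, f j) \<in> R ^^ (j - i)"
  unfolding relpow_fun_conv
  by (rule exI[of _ "\<lambda>k. f (i + k)"]) (use assms in auto)

text \<open>
  A repetition or a chord of a closed walk splits it into two shorter closed walks. Their lengths add
  up to an odd number if the original walk is odd, so one of the two is odd again.
\<close>

lemma shortest_odd_closed_walk_is_induced_cycle:
  assumes "simple_graph V E" and "odd m" and "(x, x) \<in> {(u, v). {u, v} \<in> E} ^^ m"
    and shortest: "\<And>k y. odd k \<Longrightarrow> (y, y) \<in> {(u, v). {u, v} \<in> E} ^^ k \<Longrightarrow> m \<le> k"
  shows "has_induced_cycle V E m"
proof -
  let ?R = "{(u, v). {u, v} \<in> E}"
  have edgeD: "u \<in> V" "v \<in> V" "u \<noteq> v" if "{u, v} \<in> E" for u v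
    using assms(1) that unfolding simple_graph_def by (auto simp: doubleton_eq_iff)
  obtain f where f: "f 0 = x" "f m = x" and step: "\<forall>i<m. (f i, f (Suc i)) \<in> ?R"
    using assms(3) unfolding relpow_fun_conv by blast
  have "m > 0" using \<open>odd m\<close> by (auto intro: Nat.gr0I)
  have split: "(f i, f j) \<in> ?R ^^ (j - i)" "(f j, f i) \<in> ?R ^^ (m - j + i)"
    if "i \<le> j" "j \<le> m" for i j
  proof -
    show "(f i, f j) \<in> ?R ^^ (j - i)" by (rule closed_walk_split[OF step that])
    have "(f j, x) \<in> ?R ^^ (m - j)" using closed_walk_split[OF step, of j m] that f by simp
    moreover have "(x, f i) \<in> ?R ^^ i" using closed_walk_split[OF step, of 0 i] that f by simp
    ultimately show "(f j, f i) \<in> ?R ^^ (m - j + i)" by (auto simp: relpow_add)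
  qed
  have "m \<ge> 3"
  proof -
    have "m \<noteq> 1" using assms(3) edgeD(3)[of x x] by auto
    then show ?thesis using \<open>odd m\<close> \<open>m > 0\<close> by presburger
  qed
  have inj: "f i \<noteq> f j" if "i < j" "j < m" for i j
  proof
    \<comment> \<open>A repeated vertex cuts the walk into two closed walks, one of which is odd.\<close>
    assume eq: "f i = f j"
    have "(f i, f i) \<in> ?R ^^ (j - i)" "(f i, f i) \<in> ?R ^^ (m - j + i)"
      using split[of i j] that eq by auto
    moreover have "odd (j - i) \<or> odd (m - j + i)" using \<open>odd m\<close> that by auto
    ultimately have "m \<le> j - i \<or> m \<le> m - j + i" using shortest by blast
    then show False using that by auto
  qed
  have chord: "j = Suc i \<or> (i = 0 \<and> j = m - 1)" if "i < j" "j < m" "{f i, f j} \<in> E" for i j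
  proof -
    \<comment> \<open>A chord cuts the walk into two closed walks whose lengths add up to \<open>m + 2\<close>.\<close>
    have "(f j, f i) \<in> ?R" "(f i, f j) \<in> ?R" using that(3) by (auto simp: insert_commute)
    then have "(f i, f i) \<in> ?R ^^ Suc (j - i)" "(f j, f j) \<in> ?R ^^ Suc (m - j + i)"
      using split[of i j] that by auto
    moreover have "odd (Suc (j - i)) \<or> odd (Suc (m - j + i))" using \<open>odd m\<close> that by auto
    ultimately have "m \<le> Suc (j - i) \<or> m \<le> Suc (m - j + i)" using shortest by blast
    then show ?thesis using that by auto
  qed
  have adj: "{f i, f j} \<in> E \<longleftrightarrow> j = Suc i mod m \<or> i = Suc j mod m" if "i < m" "j < m" for i j
  proof
    assume e: "{f i, f j} \<in> E"
    then have "i \<noteq> j" using edgeD(3) by metis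
    then show "j = Suc i mod m \<or> i = Suc j mod m"
      using chord[of i j] chord[of j i] e that \<open>m > 0\<close>
      by (cases "i < j") (auto simp: insert_commute)
  next
    have edge: "{f i, f (Suc i mod m)} \<in> E" if "i < m" for i
      using step that f by (cases "Suc i = m") auto
    assume "j = Suc i mod m \<or> i = Suc j mod m"
    then show "{f i, f j} \<in> E" using edge[OF \<open>i < m\<close>] edge[OF \<open>j < m\<close>]
      by (auto simp: insert_commute)
  qed
  have "distinct (map f [0..<m])"
    by (auto simp: distinct_map inj_on_def) (metis inj linorder_neqE_nat)
  moreover have "set (map f [0..<m]) \<subseteq> V" using step edgeD(1) by auto
  ultimately show ?thesis
    unfolding has_induced_cycle_def using adj \<open>m \<ge> 3\<close>
    by (intro conjI exI[of _ "map f [0..<m]"]) auto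
qed

text \<open>
  Triangles count as odd cycles here. Closed walks are better suited to the minimality argument
  than cycles: a shortest odd closed walk is automatically an induced cycle, and the absence of odd
  closed walks makes the parity of the distance to a root a well-defined colouring.
\<close>

lemma bipartite_if_no_induced_odd_cycle:
  assumes "simple_graph V E" and "\<And>m. odd m \<Longrightarrow> \<not> has_induced_cycle V E m"
  obtains A where "\<And>u v. {u, v} \<in> E \<Longrightarrow> (u \<in> A) \<noteq> (v \<in> A)"
proof -
  let ?R = "{(u, v). {u, v} \<in> E}"
  have no_odd: "even m" if "(x, x) \<in> ?R ^^ m" for x m
  proof (rule ccontr)
    assume "odd m"
    let ?P = "\<lambda>k. odd k \<and> (\<exists>y. (y, y) \<in> ?R ^^ k)"
    have P: "?P (LEAST k. ?P k)" by (rule LeastI[of ?P m]) (use that \<open>odd m\<close> in auto)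
    then obtain y where "(y, y) \<in> ?R ^^ (LEAST k. ?P k)" by blast
    with P have "has_induced_cycle V E (LEAST k. ?P k)"
      by (intro shortest_odd_closed_walk_is_induced_cycle[OF assms(1)])
         (auto intro!: Least_le)
    with P assms(2) show False by blast
  qed
  have "sym ?R" by (auto simp: sym_def insert_commute)
  then have sym: "sym (?R\<^sup>*)" by (rule sym_rtrancl)
  have sym_pow: "(v, u) \<in> ?R ^^ k" if "(u, v) \<in> ?R ^^ k" for u v k
    using that
  proof (induction k arbitrary: v)
    case (Suc k)
    then obtain z where "(u, z) \<in> ?R ^^ k" "(z, v) \<in> ?R" by auto
    then have "(z, u) \<in> ?R ^^ k" "(v, z) \<in> ?R" using Suc.IH by (auto simp: insert_commute)
    then show ?case by (rule_tac relpow_Suc_I2)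
  qed auto
  \<comment> \<open>Every component gets a root; a vertex is coloured by the parity of its walks to the root.\<close>
  define root where "root v = (SOME r. (v, r) \<in> ?R\<^sup>*)" for v
  have reach: "\<exists>k. (v, root v) \<in> ?R ^^ k" for v
    using someI[of "\<lambda>r. (v, r) \<in> ?R\<^sup>*" v] rtrancl_imp_relpow unfolding root_def by blast
  have root_eq: "root u = root v" if "{u, v} \<in> E" for u v
  proof -
    have "(u, v) \<in> ?R\<^sup>*" "(v, u) \<in> ?R\<^sup>*" using that by (auto simp: insert_commute)
    then have "(u, r) \<in> ?R\<^sup>* \<longleftrightarrow> (v, r) \<in> ?R\<^sup>*" for r by (meson rtrancl_trans)
    then show ?thesis unfolding root_def by simp
  qed
  show ?thesis
  proof (rule that[of "{v. \<exists>k. even k \<and> (v, root v) \<in> ?R ^^ k}"])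
    fix u v assume e: "{u, v} \<in> E"
    have parity: "odd (k + l)" if "(u, root u) \<in> ?R ^^ k" "(v, root v) \<in> ?R ^^ l" for k l
    proof -
      have "(root v, v) \<in> ?R ^^ l" using that(2) sym_pow by blast
      then have "(u, v) \<in> ?R ^^ (k + l)"
        using that(1) root_eq[OF e] by (auto simp: relpow_add)
      moreover have "(v, u) \<in> ?R" using e by (auto simp: insert_commute)
      ultimately have "(u, u) \<in> ?R ^^ Suc (k + l)" by auto
      from no_odd[OF this] show ?thesis by simp
    qed
    show "(u \<in> {v. \<exists>k. even k \<and> (v, root v) \<in> ?R ^^ k}) \<noteq>
          (v \<in> {v. \<exists>k. even k \<and> (v, root v) \<in> ?R ^^ k})"
      using parity reach[of u] reach[of v] by fastforce
  qed
qed

section \<open>Weighted vertex covers and packings of edges\<close>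

definition vertex_cover :: "'v set \<Rightarrow> 'v set set \<Rightarrow> 'v set \<Rightarrow> bool" where
  "vertex_cover V E C \<longleftrightarrow> C \<subseteq> V \<and> (\<forall>e\<in>E. e \<inter> C \<noteq> {})"

lemma minimum_cover_neighbour:
  fixes w :: "'v \<Rightarrow> nat"
  assumes G: "simple_graph V E" and C: "vertex_cover V E C"
    and min: "\<And>D. vertex_cover V E D \<Longrightarrow> sum w C \<le> sum w D"
    and a: "a \<in> C" "w a > 0"
  shows "\<exists>b. {a, b} \<in> E \<and> b \<notin> C \<and> w b > 0"
proof (rule ccontr)
  \<comment> \<open>Otherwise trading \<open>a\<close> for its neighbours gives a cheaper cover.\<close>
  assume "\<nexists>b. {a, b} \<in> E \<and> b \<notin> C \<and> w b > 0"
  then have zero: "w b = 0" if "{a, b} \<in> E" "b \<notin> C" for b using that by auto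
  have edges: "e \<subseteq> V" "\<exists>u v. e = {u, v} \<and> u \<noteq> v" if "e \<in> E" for e
    using G that unfolding simple_graph_def by blast+
  define N where "N = {b. {a, b} \<in> E \<and> b \<notin> C}"
  have fin: "finite V" and sub: "C \<subseteq> V" "N \<subseteq> V"
    using G C edges unfolding simple_graph_def vertex_cover_def N_def by auto
  have "vertex_cover V E (C - {a} \<union> N)"
    unfolding vertex_cover_def
  proof (intro conjI ballI)
    show "C - {a} \<union> N \<subseteq> V" using sub by auto
    fix e assume e: "e \<in> E"
    show "e \<inter> (C - {a} \<union> N) \<noteq> {}"
    proof (cases "a \<in> e")
      case True
      then obtain b where "e = {a, b}" "b \<noteq> a" using edges(2)[OF e] by auto
      then show ?thesis using e unfolding N_def by auto
    next
      case False
      then show ?thesis using C e unfolding vertex_cover_def by blast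
    qed
  qed
  from min[OF this] have "sum w C \<le> sum w (C - {a}) + sum w N"
    using fin sub by (metis (no_types, lifting) finite_subset order_trans sum.union_inter le_add1 Diff_subset)
  moreover have "sum w N = 0" using zero unfolding N_def by (simp add: sum.neutral)
  moreover have "sum w C = w a + sum w (C - {a})"
    using fin sub a by (meson finite_subset sum.remove)
  ultimately show False using a by simp
qed

text \<open>
  This is the induction step of Koenig's theorem. Among the minimum covers through \<open>a\<close>, choose one
  that is as light as possible on the side \<open>A\<close> of \<open>a\<close>; as \<open>a\<close> cannot be traded for its neighbours, some
  neighbour \<open>b\<close> of positive weight lies outside. A minimum cover that contains both \<open>a\<close> and \<open>b\<close> could
  be intersected with the chosen one on the side \<open>A\<close> and united with it on the other side, which
  moves weight away from \<open>A\<close>, against the choice.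
\<close>

lemma bipartite_edge_in_no_minimum_cover:
  fixes w :: "'v \<Rightarrow> nat"
  assumes G: "simple_graph V E" and bip: "\<And>u v. {u, v} \<in> E \<Longrightarrow> (u \<in> A) \<noteq> (v \<in> A)"
    and min: "\<And>D. vertex_cover V E D \<Longrightarrow> \<tau> \<le> sum w D"
    and C0: "vertex_cover V E C0" "sum w C0 = \<tau>" "a \<in> C0" and a: "a \<in> A" "w a > 0"
  obtains b where "{a, b} \<in> E" "w b > 0"
    "\<And>D. vertex_cover V E D \<Longrightarrow> a \<in> D \<Longrightarrow> b \<in> D \<Longrightarrow> \<tau> < sum w D"
proof -
  let ?P = "\<lambda>C. vertex_cover V E C \<and> sum w C = \<tau> \<and> a \<in> C"
  obtain C where C: "?P C" and least: "\<And>D. ?P D \<Longrightarrow> sum w (C \<inter> A) \<le> sum w (D \<inter> A)"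
    using ex_has_least_nat[of ?P C0 "\<lambda>C. sum w (C \<inter> A)"] C0 by blast
  obtain b where b: "{a, b} \<in> E" "b \<notin> C" "w b > 0"
    using minimum_cover_neighbour[OF G, of C w a] C min a by metis
  have "b \<notin> A" using bip[OF b(1)] a by simp
  have "finite V" using G by (simp add: simple_graph_def)
  have edge: "\<exists>u v. e = {u, v} \<and> u \<in> V \<and> v \<in> V \<and> u \<in> A \<and> v \<notin> A" if "e \<in> E" for e
  proof -
    have "\<exists>u v. e = {u, v} \<and> u \<in> V \<and> v \<in> V" using G that unfolding simple_graph_def by blast
    then obtain u v where "e = {u, v}" "u \<in> V" "v \<in> V" by blast
    then show ?thesis using bip[of u v] that by (cases "u \<in> A") (auto simp: insert_commute)
  qed
  have sum_on_V: "sum w Y = sum (\<lambda>v. if v \<in> Y then w v else 0) V" if "Y \<subseteq> V" for Y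
    using that \<open>finite V\<close> by (metis inf.absorb2 sum.inter_restrict)
  have "\<tau> < sum w D" if D: "vertex_cover V E D" "a \<in> D" "b \<in> D" for D
  proof (rule ccontr)
    \<comment> \<open>Covers form a lattice: intersect the sides in \<open>A\<close> and unite the other ones, or conversely.\<close>
    assume "\<not> \<tau> < sum w D"
    then have D\<tau>: "sum w D = \<tau>" using min[OF D(1)] by simp
    define M where "M = (C \<inter> D \<inter> A) \<union> ((C \<union> D) - A)"
    define J where "J = ((C \<union> D) \<inter> A) \<union> ((C \<inter> D) - A)"
    have sub: "C \<subseteq> V" "D \<subseteq> V" "M \<subseteq> V" "J \<subseteq> V"
      using C D unfolding vertex_cover_def M_def J_def by auto
    have cov: "vertex_cover V E M" "vertex_cover V E J"
      using sub C D edge unfolding vertex_cover_def M_def J_def by fastforce+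
    have "sum w M + sum w J = sum w C + sum w D"
      unfolding sum_on_V[OF sub(1)] sum_on_V[OF sub(2)] sum_on_V[OF sub(3)] sum_on_V[OF sub(4)]
        sum.distrib[symmetric]
      by (rule sum.cong) (auto simp: M_def J_def)
    then have "sum w M = \<tau>" using min[OF cov(1)] min[OF cov(2)] C D\<tau> by simp
    then have "sum w (C \<inter> A) \<le> sum w (M \<inter> A)"
      using least cov(1) C D a unfolding M_def by blast
    moreover have "sum w C + w b \<le> sum w (C \<inter> A) + sum w (M - A)"
    proof -
      have "sum w C + w b = sum w (C \<inter> A) + (sum w (C - A) + w b)"
        using sub(1) \<open>finite V\<close> by (metis add.assoc finite_subset sum.Int_Diff)
      also have "sum w (C - A) + w b = sum w (insert b (C - A))"
        using b sub(1) \<open>finite V\<close> finite_subset by (subst sum.insert) auto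
      also have "\<dots> \<le> sum w (M - A)"
        using D \<open>b \<notin> A\<close> finite_subset[OF sub(3) \<open>finite V\<close>]
        by (intro sum_mono2) (auto simp: M_def)
      finally show ?thesis by simp
    qed
    moreover have "sum w M = sum w (M \<inter> A) + sum w (M - A)"
      using sub(3) \<open>finite V\<close> by (metis finite_subset sum.Int_Diff)
    ultimately show False using \<open>sum w M = \<tau>\<close> C b(3) by linarith
  qed
  then show ?thesis using that b by blast
qed

abbreviation weight :: "'a set \<Rightarrow> ('a \<Rightarrow>\<^sub>0 nat) \<Rightarrow> nat" where
  "weight C m \<equiv> sum (expo m) C"

lemma weight_add: "weight C (m + m') = weight C m + weight C m'"
  by (simp add: lookup_add sum.distrib)

lemma weight_single: "finite C \<Longrightarrow> weight C (Poly_Mapping.single i k) = (if i \<in> C then k else 0)"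
  by (simp add: lookup_single when_def)

text \<open>
  The exponent vectors that are divisible by a product of \<open>t\<close> edge monomials; these turn out to be
  the monomials in the \<open>t\<close>-th power of the edge ideal.
\<close>

primrec packs :: "'a set set \<Rightarrow> nat \<Rightarrow> ('a \<Rightarrow>\<^sub>0 nat) \<Rightarrow> bool" where
  "packs E 0 m \<longleftrightarrow> True"
| "packs E (Suc t) m \<longleftrightarrow> (\<exists>i j m'. {i, j} \<in> E \<and>
     m = Poly_Mapping.single i 1 + Poly_Mapping.single j 1 + m' \<and> packs E t m')"

declare packs.simps(2) [simp del]

lemma packs_SucI:
  "{i, j} \<in> E \<Longrightarrow> packs E t q \<Longrightarrow>
     m = Poly_Mapping.single i 1 + Poly_Mapping.single j 1 + q \<Longrightarrow> packs E (Suc t) m"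
  unfolding packs.simps by blast

lemma packs_SucE:
  assumes "packs E (Suc t) m"
  obtains i j q where "{i, j} \<in> E" "packs E t q"
    "m = Poly_Mapping.single i 1 + Poly_Mapping.single j 1 + q"
  using assms unfolding packs.simps by blast

lemma packs_add: "packs E s m \<Longrightarrow> packs E t m' \<Longrightarrow> packs E (s + t) (m + m')"
proof (induction s arbitrary: m)
  case 0
  have "packs E t (m + m')" using "0.prems"(2)
  proof (induction t arbitrary: m')
    case (Suc t)
    from Suc.prems obtain i j q where "{i, j} \<in> E" "packs E t q"
      "m' = Poly_Mapping.single i 1 + Poly_Mapping.single j 1 + q" by (rule packs_SucE)
    then show ?case using Suc.IH[of q] by (intro packs_SucI[of i j _ _ "m + q"]) (simp_all add: add.assoc add.commute add.left_commute)
  qed simp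
  then show ?case by simp
next
  case (Suc s)
  from Suc.prems(1) obtain i j q where "{i, j} \<in> E" "packs E s q"
    "m = Poly_Mapping.single i 1 + Poly_Mapping.single j 1 + q" by (rule packs_SucE)
  then show ?case using Suc.IH[OF _ Suc.prems(2), of q] unfolding add_Suc
    by (intro packs_SucI[of i j _ _ "q + m'"]) (simp_all add: ac_simps)
qed

lemma packs_multiple: "packs E t m \<Longrightarrow> packs E t (m + m')"
  using packs_add[of E t m 0 m'] by simp

lemma packs_mono: "packs E' t m \<Longrightarrow> E' \<subseteq> E \<Longrightarrow> packs E t m"
proof (induction t arbitrary: m)
  case (Suc t)
  from Suc.prems(1) show ?case
    by (elim packs_SucE) (metis packs_SucI Suc.IH Suc.prems(2) subsetD)
qed simp

lemma packs_edge: "{i, j} \<in> E \<Longrightarrow> packs E 1 (Poly_Mapping.single i 1 + Poly_Mapping.single j 1)"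
  unfolding One_nat_def by (rule packs_SucI[of i j _ _ 0]) auto

lemma packs_Suc_split:
  assumes "packs E (Suc t) m"
  obtains m1 m2 where "m = m1 + m2" "packs E t m1" "packs E 1 m2"
  using assms by (elim packs_SucE) (metis packs_edge add.commute)

lemma split_off_edge:
  fixes m :: "'a \<Rightarrow>\<^sub>0 nat"
  assumes "a \<noteq> b" "expo m a > 0" "expo m b > 0"
  obtains m' where "m = Poly_Mapping.single a 1 + Poly_Mapping.single b 1 + m'"
proof
  show "m = Poly_Mapping.single a 1 + Poly_Mapping.single b 1 +
     (m - Poly_Mapping.single a 1 - Poly_Mapping.single b 1)"
    by (rule poly_mapping_eqI) (use assms in \<open>auto simp: lookup_add lookup_minus lookup_single when_def\<close>)
qed

text \<open>
  Koenig's theorem with vertex weights \<open>m\<close>: the largest number of edges that can be packed into \<open>m\<close>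
  is the least weight of a cover. Removing an edge of which no minimum cover contains both ends lowers
  the least weight by at most one, so edges can be removed one after the other.
\<close>

lemma bipartite_packing:
  assumes G: "simple_graph V E" and bip: "\<And>u v. {u, v} \<in> E \<Longrightarrow> (u \<in> A) \<noteq> (v \<in> A)"
    and "\<And>C. vertex_cover V E C \<Longrightarrow> t \<le> weight C m"
  shows "packs E t m"
  using assms(3)
proof (induction t arbitrary: m)
  case (Suc t)
  have edges: "e \<subseteq> V" "\<exists>u v. e = {u, v} \<and> u \<noteq> v" if "e \<in> E" for e
    using G that unfolding simple_graph_def by blast+
  then have "vertex_cover V E V" unfolding vertex_cover_def by fastforce
  then obtain C0 where C0: "vertex_cover V E C0"
    and min: "\<And>D. vertex_cover V E D \<Longrightarrow> weight C0 m \<le> weight D m"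
    using ex_has_least_nat[of "vertex_cover V E" V "\<lambda>C. weight C m"] by blast
  have "weight C0 m > 0" using Suc.prems[OF C0] by simp
  then obtain a where a: "a \<in> C0" "expo m a > 0"
    by (metis gr0I less_irrefl sum.neutral)
  obtain b where b: "{a, b} \<in> E" "expo m b > 0"
    and more: "\<And>D. vertex_cover V E D \<Longrightarrow> a \<in> D \<Longrightarrow> b \<in> D \<Longrightarrow> weight C0 m < weight D m"
  proof (cases "a \<in> A")
    case True
    then show ?thesis
      using bipartite_edge_in_no_minimum_cover[OF G bip min C0 refl a(1)] a that by metis
  next
    case False
    have "(u \<in> - A) \<noteq> (v \<in> - A)" if "{u, v} \<in> E" for u v using bip[OF that] by simp
    then show ?thesis
      using bipartite_edge_in_no_minimum_cover[OF G _ min C0 refl a(1), of "- A"] a that False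
      by (metis ComplI)
  qed
  have "a \<noteq> b" using edges(2)[OF b(1)] by auto
  then obtain m' where m: "m = Poly_Mapping.single a 1 + Poly_Mapping.single b 1 + m'"
    using split_off_edge a(2) b(2) by metis
  have "t \<le> weight D m'" if D: "vertex_cover V E D" for D
  proof -
    have "finite D" using D G unfolding vertex_cover_def simple_graph_def by (meson finite_subset)
    then have "weight D m = (if a \<in> D then 1 else 0) + (if b \<in> D then 1 else 0) + weight D m'"
      unfolding m weight_add by (simp add: weight_single)
    then show ?thesis using more[OF D] Suc.prems[OF D] Suc.prems[OF C0]
      by (auto split: if_splits)
  qed
  then have "packs E t m'" by (rule Suc.IH)
  then show ?case using b(1) m packs_SucI by metis
qed simp

section \<open>Subrings of a type of class \<open>comm_ring_1\<close>\<close>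

abbreviation type_subring :: "'a::comm_ring_1 set \<Rightarrow> 'a ring" where
  "type_subring C \<equiv> ring_of_type_algebra\<lparr>carrier := C\<rparr>"

lemma type_subring_simps:
  "carrier (type_subring C) = C"
  "x \<otimes>\<^bsub>type_subring C\<^esub> y = x * y" "x \<oplus>\<^bsub>type_subring C\<^esub> y = x + y"
  "\<one>\<^bsub>type_subring C\<^esub> = 1" "\<zero>\<^bsub>type_subring C\<^esub> = 0"
  "x \<otimes>\<^bsub>ring_of_type_algebra\<^esub> y = x * y" "x \<oplus>\<^bsub>ring_of_type_algebra\<^esub> y = x + y"
  "\<one>\<^bsub>ring_of_type_algebra\<^esub> = (1::'a::comm_ring_1)" "\<zero>\<^bsub>ring_of_type_algebra\<^esub> = (0::'a::comm_ring_1)"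
  by (simp_all add: ring_of_type_algebra_def)

lemma cring_type_subring:
  assumes "1 \<in> C" and "\<And>x y. x \<in> C \<Longrightarrow> y \<in> C \<Longrightarrow> x + y \<in> C"
    and "\<And>x y. x \<in> C \<Longrightarrow> y \<in> C \<Longrightarrow> x * y \<in> C" and "\<And>x. x \<in> C \<Longrightarrow> - x \<in> C"
  shows "cring (type_subring C)"
proof -
  have "0 \<in> C" using assms(2)[OF assms(1) assms(4)[OF assms(1)]] by simp
  moreover have neg: "\<exists>y\<in>C. y + x = 0" if "x \<in> C" for x
    using assms(4)[OF that] by (intro bexI[of _ "- x"]) simp_all
  ultimately have "abelian_group (type_subring C)"
    using assms
    by (intro abelian_groupI) (auto simp: type_subring_simps add.assoc add.commute neg)
  moreover have "comm_monoid (type_subring C)"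
    using assms by (intro comm_monoidI) (auto simp: type_subring_simps algebra_simps)
  ultimately show ?thesis
    using assms by (intro cringI) (auto simp: type_subring_simps algebra_simps)
qed

lemma ideal_type_subring:
  assumes "cring (type_subring C)"
  shows "ideal J (type_subring C) \<longleftrightarrow>
    J \<subseteq> C \<and> 0 \<in> J \<and> (\<forall>x\<in>J. \<forall>y\<in>J. x + y \<in> J) \<and> (\<forall>r\<in>C. \<forall>x\<in>J. r * x \<in> J)"
    (is "?L \<longleftrightarrow> ?R")
proof
  interpret cring "type_subring C" by fact
  show ?R if ?L
  proof -
    interpret J: ideal J "type_subring C" by fact
    show ?R using J.a_subset J.zero_closed J.a_closed J.I_l_closed
      by (auto simp: type_subring_simps)
  qed
  show ?L if ?R
  proof (rule idealI)
    have "1 \<in> C" using one_closed by (simp add: type_subring_simps)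
    then have "\<ominus>\<^bsub>type_subring C\<^esub> 1 \<in> C"
      using a_inv_closed[of 1] by (simp add: type_subring_simps)
    moreover have "\<ominus>\<^bsub>type_subring C\<^esub> 1 = - 1"
      using l_neg[of 1] \<open>1 \<in> C\<close> by (simp add: type_subring_simps add_eq_0_iff2)
    ultimately have "- 1 \<in> C" by simp
    show "subgroup J (add_monoid (type_subring C))"
    proof (rule add.subgroupI)
      fix x assume x: "x \<in> J"
      then have "\<ominus>\<^bsub>type_subring C\<^esub> x = - x"
        using l_neg[of x] that by (auto simp: type_subring_simps add_eq_0_iff2)
      moreover have "- x \<in> J" using that x \<open>- 1 \<in> C\<close> by force
      ultimately show "\<ominus>\<^bsub>type_subring C\<^esub> x \<in> J" by simp
    qed (use that in \<open>auto simp: type_subring_simps\<close>)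
  next
    fix a x assume ax: "a \<in> J" "x \<in> carrier (type_subring C)"
    then show "x \<otimes>\<^bsub>type_subring C\<^esub> a \<in> J" using that by (simp add: type_subring_simps)
    then show "a \<otimes>\<^bsub>type_subring C\<^esub> x \<in> J" by (simp add: type_subring_simps mult.commute)
  qed (rule ring_axioms)
qed

section \<open>Quotient modules\<close>

lemma quot_module_simps:
  "carrier (quot_module R I J) = {J +>\<^bsub>R\<^esub> x | x. x \<in> I}" "\<zero>\<^bsub>quot_module R I J\<^esub> = J"
  "r \<odot>\<^bsub>quot_module R I J\<^esub> C = (\<Union>x\<in>C. J +>\<^bsub>R\<^esub> (r \<otimes>\<^bsub>R\<^esub> x))"
  by (simp_all add: quot_module_def)

lemma (in ideal) coset_eq_self_iff: "x \<in> carrier R \<Longrightarrow> I +> x = I \<longleftrightarrow> x \<in> I"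
  using rcos_const_imp_mem a_rcos_zero[OF is_ideal] by blast

text \<open>
  The scalar multiplication of \<^const>\<open>quot_module\<close> is a union over a coset; all members of that
  union coincide.
\<close>

lemma quot_module_smult:
  fixes R (structure)
  assumes "ideal J R" "r \<in> carrier R" "x \<in> carrier R"
  shows "r \<odot>\<^bsub>quot_module R I J\<^esub> (J +> x) = J +> (r \<otimes> x)"
proof -
  interpret ideal J R by fact
  have "J +> (r \<otimes> y) = J +> (r \<otimes> x)" if y: "y \<in> J +> x" for y
  proof -
    obtain j where j: "j \<in> J" "y = j \<oplus> x" using y unfolding a_r_coset_def' by blast
    then have "r \<otimes> y = r \<otimes> j \<oplus> r \<otimes> x" using assms by (simp add: r_distr Icarr)
    moreover have "r \<otimes> j \<in> J" using j assms I_l_closed by blast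
    ultimately have "r \<otimes> y \<in> J +> (r \<otimes> x)" unfolding a_r_coset_def' by blast
    then show ?thesis using a_repr_independence assms a_subgroup by simp
  qed
  moreover have "J +> x \<noteq> {}" using assms(3) a_rcos_self by blast
  ultimately show ?thesis unfolding quot_module_simps by blast
qed

lemma quot_module_smult_zero_iff:
  fixes R (structure)
  assumes "ideal J R" "r \<in> carrier R" "x \<in> carrier R"
  shows "r \<odot>\<^bsub>quot_module R I J\<^esub> (J +> x) = \<zero>\<^bsub>quot_module R I J\<^esub> \<longleftrightarrow> r \<otimes> x \<in> J"
  using assms by (simp add: quot_module_smult quot_module_simps(2) ideal.coset_eq_self_iff
      ideal.axioms(2) ring.ring_simprules(5))

lemma annihilator_quot_module:
  assumes "ideal J R" "I \<subseteq> carrier R"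
  shows "annihilator R (quot_module R I J) = {r \<in> carrier R. \<forall>f\<in>I. r \<otimes>\<^bsub>R\<^esub> f \<in> J}"
  unfolding annihilator_def quot_module_simps(1)
  using assms quot_module_smult_zero_iff[OF assms(1)] by blast

lemma quot_module_trivial_iff:
  assumes "ideal J R" "I \<subseteq> carrier R" "I \<noteq> {}"
  shows "carrier (quot_module R I J) = {\<zero>\<^bsub>quot_module R I J\<^esub>} \<longleftrightarrow> I \<subseteq> J"
proof -
  have "J +>\<^bsub>R\<^esub> x = J \<longleftrightarrow> x \<in> J" if "x \<in> I" for x
    using ideal.coset_eq_self_iff[OF assms(1)] assms(2) that by blast
  then show ?thesis unfolding quot_module_simps using assms(3) by auto
qed

lemma associated_primes_quot_module:
  assumes "ideal J R"
  shows "associated_primes R (quot_module R (carrier R) J) =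
    {P. primeideal P R \<and> (\<exists>g\<in>carrier R. P = {r \<in> carrier R. r \<otimes>\<^bsub>R\<^esub> g \<in> J})}"
proof -
  have "{r \<in> carrier R. r \<odot>\<^bsub>quot_module R (carrier R) J\<^esub> (J +>\<^bsub>R\<^esub> g) = \<zero>\<^bsub>quot_module R (carrier R) J\<^esub>}
      = {r \<in> carrier R. r \<otimes>\<^bsub>R\<^esub> g \<in> J}" if "g \<in> carrier R" for g
    using quot_module_smult_zero_iff[OF assms _ that] by blast
  then show ?thesis
    unfolding associated_primes_def quot_module_simps(1) by blast
qed

lemma ideal_annihilator_quot_module:
  assumes "cring R" "ideal J R" "I \<subseteq> carrier R"
  shows "ideal (annihilator R (quot_module R I J)) R"
proof -
  interpret cring R by fact
  interpret J: ideal J R by fact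
  show ?thesis unfolding annihilator_quot_module[OF assms(2,3)]
  proof (rule idealI)
    show "subgroup {r \<in> carrier R. \<forall>f\<in>I. r \<otimes>\<^bsub>R\<^esub> f \<in> J} (add_monoid R)"
    proof (rule add.subgroupI)
      show "{r \<in> carrier R. \<forall>f\<in>I. r \<otimes>\<^bsub>R\<^esub> f \<in> J} \<noteq> {}"
        using assms(3) J.zero_closed by (auto intro!: exI[of _ "\<zero>\<^bsub>R\<^esub>"])
    qed (use assms(3) in \<open>auto simp: l_distr l_minus subset_iff J.a_inv_closed\<close>)
  next
    fix a x assume "a \<in> {r \<in> carrier R. \<forall>f\<in>I. r \<otimes>\<^bsub>R\<^esub> f \<in> J}" "x \<in> carrier R"
    then show "x \<otimes>\<^bsub>R\<^esub> a \<in> {r \<in> carrier R. \<forall>f\<in>I. r \<otimes>\<^bsub>R\<^esub> f \<in> J}"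
      using assms(3) J.I_l_closed by (auto simp: m_assoc subset_iff)
    then show "a \<otimes>\<^bsub>R\<^esub> x \<in> {r \<in> carrier R. \<forall>f\<in>I. r \<otimes>\<^bsub>R\<^esub> f \<in> J}"
      using \<open>a \<in> _\<close> \<open>x \<in> _\<close> by (simp add: m_comm)
  qed (rule ring_axioms)
qed

section \<open>Primes of a quotient ring\<close>

lemma quot_primeideal_preimage:
  assumes "cring R" "ideal A R" "primeideal Q (R Quot A)"
  shows "primeideal (\<Union>Q) R \<and> A \<subseteq> \<Union>Q \<and> (+>\<^bsub>R\<^esub>) A ` \<Union>Q = Q"
proof (intro conjI)
  interpret cring R by fact
  have Q: "ideal Q (R Quot A)" using assms(3) by (rule primeideal.axioms)
  have "\<Union>Q = {r \<in> carrier R. A +>\<^bsub>R\<^esub> r \<in> Q}"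
    using canonical_proj_vimage_in_carrier[OF assms(2), of Q]
      canonical_proj_vimage_mem_iff[OF assms(2), of Q]
      additive_subgroup.a_subset[OF ideal.axioms(1)[OF Q]] by blast
  then show "primeideal (\<Union>Q) R"
    using ring_hom_ring.primeideal_vimage[OF ideal.rcos_ring_hom_ring[OF assms(2)] assms(1,3)] by simp
  show "A \<subseteq> \<Union>Q" "(+>\<^bsub>R\<^esub>) A ` \<Union>Q = Q"
  proof -
    have bij: "bij_betw (\<lambda>J. (+>\<^bsub>R\<^esub>) A ` J) {J. ideal J R \<and> A \<subseteq> J} {J. ideal J (R Quot A)}"
      by (rule quot_ideal_correspondence[OF assms(2)])
    then obtain J where J: "ideal J R" "A \<subseteq> J" "Q = (+>\<^bsub>R\<^esub>) A ` J"
      using Q unfolding bij_betw_def by blast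
    have J_eq: "\<Union>Q = J" using ideal_incl_iff[OF assms(2) J(1)] J(2) unfolding J(3) by simp
    show "A \<subseteq> \<Union>Q" unfolding J_eq by (rule J(2))
    show "(+>\<^bsub>R\<^esub>) A ` \<Union>Q = Q" unfolding J_eq by (rule J(3)[symmetric])
  qed
qed

lemma quot_primeideal_image:
  assumes "cring R" "ideal A R" "primeideal P R" "A \<subseteq> P"
  shows "primeideal ((+>\<^bsub>R\<^esub>) A ` P) (R Quot A) \<and> \<Union>((+>\<^bsub>R\<^esub>) A ` P) = P"
proof
  interpret cring R by fact
  interpret P: primeideal P R by fact
  have P: "ideal P R" by (rule P.is_ideal)
  show union: "\<Union>((+>\<^bsub>R\<^esub>) A ` P) = P"
    using ideal_incl_iff[OF assms(2) P] assms(4) by simp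
  have Q: "ideal ((+>\<^bsub>R\<^esub>) A ` P) (R Quot A)"
    using ring_ideal_imp_quot_ideal[OF assms(2) P] .
  have mem: "A +>\<^bsub>R\<^esub> a \<in> (+>\<^bsub>R\<^esub>) A ` P \<longleftrightarrow> a \<in> P" if "a \<in> carrier R" for a
    using canonical_proj_vimage_mem_iff[OF assms(2) _ that, of "(+>\<^bsub>R\<^esub>) A ` P"] union
      additive_subgroup.a_subset[OF ideal.axioms(1)[OF Q]] by simp
  have carr: "carrier (R Quot A) = {A +>\<^bsub>R\<^esub> a | a. a \<in> carrier R}"
    unfolding FactRing_def A_RCOSETS_def' by auto
  show "primeideal ((+>\<^bsub>R\<^esub>) A ` P) (R Quot A)"
  proof (rule primeidealI)
    show "cring (R Quot A)" by (rule ideal.quotient_is_cring[OF assms(2,1)])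
    obtain x where x: "x \<in> carrier R" "x \<notin> P" using P.I_notcarr P.a_subset by blast
    then have "A +>\<^bsub>R\<^esub> x \<in> carrier (R Quot A)" "A +>\<^bsub>R\<^esub> x \<notin> (+>\<^bsub>R\<^esub>) A ` P"
      using mem[OF x(1)] unfolding carr by (blast, metis)
    then show "carrier (R Quot A) \<noteq> (+>\<^bsub>R\<^esub>) A ` P" by metis
    fix a b assume "a \<in> carrier (R Quot A)" "b \<in> carrier (R Quot A)"
      and ab: "a \<otimes>\<^bsub>R Quot A\<^esub> b \<in> (+>\<^bsub>R\<^esub>) A ` P"
    then obtain x y where xy: "x \<in> carrier R" "a = A +>\<^bsub>R\<^esub> x" "y \<in> carrier R" "b = A +>\<^bsub>R\<^esub> y"
      unfolding carr by blast
    then have "A +>\<^bsub>R\<^esub> (x \<otimes>\<^bsub>R\<^esub> y) \<in> (+>\<^bsub>R\<^esub>) A ` P"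
      using ab ideal.rcoset_mult_add[OF assms(2)] by (simp add: FactRing_def)
    then have "x \<otimes>\<^bsub>R\<^esub> y \<in> P" using mem xy by simp
    then show "a \<in> (+>\<^bsub>R\<^esub>) A ` P \<or> b \<in> (+>\<^bsub>R\<^esub>) A ` P" using P.I_prime xy mem by blast
  qed (rule Q)
qed

text \<open>
  Chains of primes of \<open>R / A\<close> and chains of primes of \<open>R\<close> above \<open>A\<close> correspond to each other by
  taking preimages and images under the projection.
\<close>

lemma krull_dim_quot:
  assumes "cring R" "ideal A R"
  shows "krull_dim (R Quot A) =
     Sup {ereal (real m) | m. \<exists>P :: nat \<Rightarrow> 'a set.
            (\<forall>i\<le>m. primeideal (P i) R \<and> A \<subseteq> P i) \<and> (\<forall>i<m. P i \<subset> P (Suc i))}"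
proof -
  have "(\<exists>Q :: nat \<Rightarrow> 'a set set.
           (\<forall>i\<le>m. primeideal (Q i) (R Quot A)) \<and> (\<forall>i<m. Q i \<subset> Q (Suc i))) \<longleftrightarrow>
        (\<exists>P :: nat \<Rightarrow> 'a set.
            (\<forall>i\<le>m. primeideal (P i) R \<and> A \<subseteq> P i) \<and> (\<forall>i<m. P i \<subset> P (Suc i)))" (is "?L \<longleftrightarrow> ?R") for m
  proof
    assume ?L
    then obtain Q where Q: "\<forall>i\<le>m. primeideal (Q i) (R Quot A)" "\<forall>i<m. Q i \<subset> Q (Suc i)" by blast
    have pre: "primeideal (\<Union>(Q i)) R \<and> A \<subseteq> \<Union>(Q i) \<and> (+>\<^bsub>R\<^esub>) A ` \<Union>(Q i) = Q i" if "i \<le> m" for i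
      using quot_primeideal_preimage[OF assms] Q(1) that by blast
    have "\<Union>(Q i) \<subset> \<Union>(Q (Suc i))" if "i < m" for i
    proof
      show "\<Union>(Q i) \<subseteq> \<Union>(Q (Suc i))" using Q(2) that by blast
      show "\<Union>(Q i) \<noteq> \<Union>(Q (Suc i))"
        using pre[of i] pre[of "Suc i"] Q(2) that by (metis Suc_leI less_imp_le_nat psubset_eq)
    qed
    then show ?R using pre by (intro exI[of _ "\<lambda>i. \<Union>(Q i)"]) blast
  next
    assume ?R
    then obtain P where P: "\<forall>i\<le>m. primeideal (P i) R \<and> A \<subseteq> P i" "\<forall>i<m. P i \<subset> P (Suc i)" by blast
    have im: "primeideal ((+>\<^bsub>R\<^esub>) A ` P i) (R Quot A) \<and> \<Union>((+>\<^bsub>R\<^esub>) A ` P i) = P i" if "i \<le> m" for i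
      using quot_primeideal_image[OF assms] P(1) that by blast
    have "(+>\<^bsub>R\<^esub>) A ` P i \<subset> (+>\<^bsub>R\<^esub>) A ` P (Suc i)" if "i < m" for i
    proof
      show "(+>\<^bsub>R\<^esub>) A ` P i \<subseteq> (+>\<^bsub>R\<^esub>) A ` P (Suc i)" using P(2) that by blast
      show "(+>\<^bsub>R\<^esub>) A ` P i \<noteq> (+>\<^bsub>R\<^esub>) A ` P (Suc i)"
        using im[of i] im[of "Suc i"] P(2) that by (metis Suc_leI less_imp_le_nat psubset_eq)
    qed
    then show ?L using im by (intro exI[of _ "\<lambda>i. (+>\<^bsub>R\<^esub>) A ` P i"]) blast
  qed
  then show ?thesis unfolding krull_dim_def by simp
qed

text \<open>
  Two annihilators can thus be compared without computing either of them: only the closed sets that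
  they define in the spectrum matter.
\<close>

lemma krull_dim_quot_cong:
  assumes "cring R" "ideal A R" "ideal B R"
    and "\<And>P. primeideal P R \<Longrightarrow> A \<subseteq> P \<longleftrightarrow> B \<subseteq> P"
  shows "krull_dim (R Quot A) = krull_dim (R Quot B)"
proof -
  have "(\<forall>i\<le>m. primeideal (P i) R \<and> A \<subseteq> P i) \<longleftrightarrow> (\<forall>i\<le>m. primeideal (P i) R \<and> B \<subseteq> P i)"
    for m :: nat and P :: "nat \<Rightarrow> 'a set" using assms(4) by blast
  then show ?thesis unfolding krull_dim_quot[OF assms(1,2)] krull_dim_quot[OF assms(1,3)] by simp
qed

section \<open>Monomial ideals\<close>

lemma mpoly_carrier_iff:
  "f \<in> carrier (mpoly_ring n) \<longleftrightarrow> (\<forall>m\<in>Poly_Mapping.keys f. Poly_Mapping.keys m \<subseteq> {1..n})"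
  by (simp add: mpoly_ring_def)

lemma mpoly_ring_eq: "mpoly_ring n = type_subring (carrier (mpoly_ring n))"
  by (simp add: mpoly_ring_def)

lemma mpoly_ring_ops:
  "x \<otimes>\<^bsub>mpoly_ring n\<^esub> y = x * y" "x \<oplus>\<^bsub>mpoly_ring n\<^esub> y = x + y"
  "\<one>\<^bsub>mpoly_ring n\<^esub> = 1" "\<zero>\<^bsub>mpoly_ring n\<^esub> = 0"
  by (simp_all add: mpoly_ring_def type_subring_simps)

lemma keys_multE:
  assumes "m \<in> Poly_Mapping.keys (f * g)"
  obtains a b where "m = a + b" "a \<in> Poly_Mapping.keys f" "b \<in> Poly_Mapping.keys g"
  using assms keys_mult[of f g] by auto

lemma mpoly_carrier_closed:
  fixes f g :: "'k::comm_ring_1 mpoly"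
  assumes "f \<in> carrier (mpoly_ring n)" "g \<in> carrier (mpoly_ring n)"
  shows "f + g \<in> carrier (mpoly_ring n)" "f * g \<in> carrier (mpoly_ring n)"
proof -
  have "Poly_Mapping.keys m \<subseteq> {1..n}" if "m \<in> Poly_Mapping.keys (f + g)" for m
    using that assms Poly_Mapping.keys_add[of f g] unfolding mpoly_carrier_iff by blast
  then show "f + g \<in> carrier (mpoly_ring n)" unfolding mpoly_carrier_iff by blast
  have "Poly_Mapping.keys m \<subseteq> {1..n}" if "m \<in> Poly_Mapping.keys (f * g)" for m
  proof -
    obtain a b where "m = a + b" "a \<in> Poly_Mapping.keys f" "b \<in> Poly_Mapping.keys g"
      using \<open>m \<in> _\<close> by (rule keys_multE)
    then show ?thesis using assms Poly_Mapping.keys_add[of a b] unfolding mpoly_carrier_iff by blast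
  qed
  then show "f * g \<in> carrier (mpoly_ring n)" unfolding mpoly_carrier_iff by blast
qed

lemma cring_mpoly_ring: "cring (mpoly_ring n)"
proof -
  have "cring (type_subring (carrier (mpoly_ring n) :: 'a mpoly set))"
    by (rule cring_type_subring)
       (simp_all add: mpoly_carrier_closed, simp_all add: mpoly_carrier_iff in_keys_iff)
  then show ?thesis by (simp add: mpoly_ring_eq[symmetric])
qed

lemma ideal_mpoly_ring:
  "ideal J (mpoly_ring n) \<longleftrightarrow> J \<subseteq> carrier (mpoly_ring n) \<and> 0 \<in> J \<and>
     (\<forall>x\<in>J. \<forall>y\<in>J. x + y \<in> J) \<and> (\<forall>r\<in>carrier (mpoly_ring n). \<forall>x\<in>J. r * x \<in> J)"
  using ideal_type_subring[of "carrier (mpoly_ring n)" J] cring_mpoly_ring[of n]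
  unfolding mpoly_ring_eq[symmetric] by blast

lemma poly_eq_sum_monomials:
  "f = (\<Sum>m\<in>Poly_Mapping.keys f. Poly_Mapping.single m (expo f m))"
proof (rule poly_mapping_eqI)
  fix k
  have "(\<Sum>m\<in>Poly_Mapping.keys f. expo (Poly_Mapping.single m (expo f m)) k)
      = (\<Sum>m\<in>Poly_Mapping.keys f. if k = m then expo f m else 0)"
    by (rule sum.cong) (auto simp: lookup_single when_def)
  also have "\<dots> = expo f k" by (simp add: in_keys_iff)
  finally show "expo f k = expo (\<Sum>m\<in>Poly_Mapping.keys f. Poly_Mapping.single m (expo f m)) k"
    by (simp add: lookup_sum)
qed

lemma ideal_mpoly_ring_sum:
  fixes J :: "'k::comm_ring_1 mpoly set"
  assumes "ideal J (mpoly_ring n)" "\<And>x. x \<in> A \<Longrightarrow> h x \<in> J"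
  shows "sum h A \<in> J"
  using assms(2)
  by (induction A rule: infinite_finite_induct) (use assms(1) in \<open>auto simp: ideal_mpoly_ring\<close>)

lemma ideal_memI_monomials:
  fixes J :: "'k::comm_ring_1 mpoly set"
  assumes "ideal J (mpoly_ring n)"
    and "\<And>m. m \<in> Poly_Mapping.keys f \<Longrightarrow> Poly_Mapping.single m (expo f m) \<in> J"
  shows "f \<in> J"
  by (subst poly_eq_sum_monomials) (rule ideal_mpoly_ring_sum[OF assms])

text \<open>
  The powers of the edge ideal and of the primes of vertex covers have this form: \<open>Q\<close> is divisibility
  by a product of edges in the first case and a lower bound on a weight in the second.
\<close>

definition monomial_ideal :: "nat \<Rightarrow> ((nat \<Rightarrow>\<^sub>0 nat) \<Rightarrow> bool) \<Rightarrow> 'k::comm_ring_1 mpoly set" where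
  "monomial_ideal n Q = {f \<in> carrier (mpoly_ring n). \<forall>m\<in>Poly_Mapping.keys f. Q m}"

lemma ideal_monomial_ideal:
  assumes "\<And>m m'. Q m \<Longrightarrow> Q (m + m')"
  shows "ideal (monomial_ideal n Q :: 'k::comm_ring_1 mpoly set) (mpoly_ring n)"
  unfolding ideal_mpoly_ring
proof (intro conjI ballI)
  show "0 \<in> monomial_ideal n Q" by (simp add: monomial_ideal_def mpoly_carrier_iff)
next
  fix x y :: "'k mpoly" assume "x \<in> monomial_ideal n Q" "y \<in> monomial_ideal n Q"
  then show "x + y \<in> monomial_ideal n Q"
    using Poly_Mapping.keys_add[of x y] mpoly_carrier_closed(1)[of x n y] unfolding monomial_ideal_def by blast
next
  fix r x :: "'k mpoly" assume r: "r \<in> carrier (mpoly_ring n)" and x: "x \<in> monomial_ideal n Q"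
  have "Q m" if "m \<in> Poly_Mapping.keys (r * x)" for m
  proof -
    obtain a b where "m = a + b" "b \<in> Poly_Mapping.keys x" using \<open>m \<in> _\<close> by (rule keys_multE)
    then show ?thesis using x assms[of b a] unfolding monomial_ideal_def by (simp add: add.commute)
  qed
  then show "r * x \<in> monomial_ideal n Q"
    using r x mpoly_carrier_closed(2)[of r n x] unfolding monomial_ideal_def by blast
qed (auto simp: monomial_ideal_def)

lemma keys_summand: "Poly_Mapping.keys (m::'a \<Rightarrow>\<^sub>0 nat) \<subseteq> Poly_Mapping.keys (m + m')"
  "Poly_Mapping.keys (m::'a \<Rightarrow>\<^sub>0 nat) \<subseteq> Poly_Mapping.keys (m' + m)"
  by (auto simp: in_keys_iff lookup_add)

lemma single_in_mpoly_carrier: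
  "Poly_Mapping.keys m \<subseteq> {1..n} \<Longrightarrow> Poly_Mapping.single m c \<in> carrier (mpoly_ring n)"
  by (simp add: mpoly_carrier_iff)

lemma indet_in_carrier: "i \<in> {1..n} \<Longrightarrow> indet i \<in> carrier (mpoly_ring n)"
  unfolding indet_def by (intro single_in_mpoly_carrier) simp

lemma simple_graph_edgeD:
  assumes "simple_graph V E" "{i, j} \<in> E"
  shows "i \<in> V" "j \<in> V" "i \<noteq> j"
  using assms unfolding simple_graph_def by (auto simp: doubleton_eq_iff)

lemma edge_ideal_eq:
  assumes G: "simple_graph {1..n} E"
  shows "edge_ideal n E = (monomial_ideal n (packs E 1) :: 'k::comm_ring_1 mpoly set)"
proof
  have "ideal (monomial_ideal n (packs E 1) :: 'k mpoly set) (mpoly_ring n)"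
    by (rule ideal_monomial_ideal) (rule packs_multiple)
  moreover have "indet i * indet j \<in> (monomial_ideal n (packs E 1) :: 'k mpoly set)" if "{i, j} \<in> E" for i j
    using simple_graph_edgeD[OF G that] packs_edge[OF that]
      mpoly_carrier_closed(2)[OF indet_in_carrier indet_in_carrier, of i n j]
    by (auto simp: monomial_ideal_def indet_def mult_single)
  ultimately show "edge_ideal n E \<subseteq> (monomial_ideal n (packs E 1) :: 'k mpoly set)"
    unfolding edge_ideal_def genideal_def by blast
  show "(monomial_ideal n (packs E 1) :: 'k mpoly set) \<subseteq> edge_ideal n E"
    unfolding edge_ideal_def genideal_def
  proof (intro subsetI InterI, clarify)
    fix f :: "'k mpoly" and J :: "'k mpoly set" assume f: "f \<in> monomial_ideal n (packs E 1)"
      and J: "ideal J (mpoly_ring n)" "{indet i * indet j |i j. {i, j} \<in> E} \<subseteq> J"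
    show "f \<in> J"
    proof (rule ideal_memI_monomials[OF J(1)])
      fix m assume m: "m \<in> Poly_Mapping.keys f"
      then have "packs E (Suc 0) m" "Poly_Mapping.keys m \<subseteq> {1..n}"
        using f by (auto simp: monomial_ideal_def mpoly_carrier_iff)
      then obtain i j q where e: "{i, j} \<in> E" and q: "Poly_Mapping.keys q \<subseteq> {1..n}"
        and m_eq: "m = Poly_Mapping.single i 1 + Poly_Mapping.single j 1 + q"
        by (elim packs_SucE) (metis keys_summand(2) subset_trans)
      have "Poly_Mapping.single m (expo f m) =
          Poly_Mapping.single q (expo f m) * (indet i * indet j)"
        unfolding m_eq indet_def mult_single by (simp add: add.commute)
      moreover have "indet i * indet j \<in> J" using J(2) e by blast
      moreover have "Poly_Mapping.single q (expo f m) \<in> carrier (mpoly_ring n)"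
        by (rule single_in_mpoly_carrier[OF q])
      ultimately show "Poly_Mapping.single m (expo f m) \<in> J"
        using J(1) by (simp add: ideal_mpoly_ring)
    qed
  qed
qed

lemma ideal_monomial_ideal_packs: "ideal (monomial_ideal n (packs E t)) (mpoly_ring n)"
  by (rule ideal_monomial_ideal) (rule packs_multiple)

text \<open>
  A product of ideals consists of sums of products, so it suffices to factor single monomials.
\<close>

lemma ideal_power_eq:
  "ideal_power (mpoly_ring n) (monomial_ideal n (packs E 1)) t
     = (monomial_ideal n (packs E t) :: 'k::comm_ring_1 mpoly set)"
proof (induction t)
  case 0
  show ?case by (simp add: ideal_power_def nat_pow_def ideals_set_def monomial_ideal_def)
next
  case (Suc t)
  let ?R = "mpoly_ring n :: 'k mpoly ring"
  let ?I = "\<lambda>t. monomial_ideal n (packs E t) :: 'k mpoly set"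
  have "ideal_power ?R (?I 1) (Suc t) = ideal_prod ?R (?I t) (?I 1)"
    using Suc.IH by (simp add: ideal_power_def nat_pow_def ideals_set_def del: packs.simps)
  also have "\<dots> = ?I (Suc t)"
  proof
    show "ideal_prod ?R (?I t) (?I 1) \<subseteq> ?I (Suc t)"
    proof
      fix f assume "f \<in> ideal_prod ?R (?I t) (?I 1)"
      then show "f \<in> ?I (Suc t)"
      proof induction
        case (prod f g)
        have "packs E (Suc t) m" if "m \<in> Poly_Mapping.keys (f * g)" for m
        proof -
          obtain a b where "m = a + b" "a \<in> Poly_Mapping.keys f" "b \<in> Poly_Mapping.keys g"
            using \<open>m \<in> _\<close> by (rule keys_multE)
          then show ?thesis using prod packs_add[of E t a 1 b] by (simp add: monomial_ideal_def)
        qed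
        then show ?case using prod mpoly_carrier_closed(2)[of f n g]
          by (simp add: monomial_ideal_def mpoly_ring_ops)
      next
        case (sum f g)
        moreover have "ideal (?I (Suc t)) ?R" by (rule ideal_monomial_ideal_packs)
        ultimately show ?case by (simp add: mpoly_ring_ops ideal_mpoly_ring)
      qed
    qed
    have prod_ideal: "ideal (ideal_prod ?R (?I t) (?I 1)) ?R"
      using cring_mpoly_ring by (intro ring.ideal_prod_is_ideal ideal_monomial_ideal_packs cring.axioms)
    show "?I (Suc t) \<subseteq> ideal_prod ?R (?I t) (?I 1)"
    proof
      fix f assume f: "f \<in> ?I (Suc t)"
      show "f \<in> ideal_prod ?R (?I t) (?I 1)"
      proof (rule ideal_memI_monomials[OF prod_ideal])
        fix m assume m: "m \<in> Poly_Mapping.keys f"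
        then have "packs E (Suc t) m" and carr: "Poly_Mapping.keys m \<subseteq> {1..n}"
          using f by (auto simp: monomial_ideal_def mpoly_carrier_iff)
        then obtain a b where ab: "m = a + b" "packs E t a" "packs E 1 b"
          by (rule_tac packs_Suc_split)
        then have "Poly_Mapping.keys a \<subseteq> {1..n}" "Poly_Mapping.keys b \<subseteq> {1..n}"
          using carr keys_summand(1)[of a b] keys_summand(2)[of b a] by auto
        then have "Poly_Mapping.single a (expo f m) \<in> ?I t" "Poly_Mapping.single b 1 \<in> ?I 1"
          using ab(2,3) by (auto simp: monomial_ideal_def single_in_mpoly_carrier)
        from ideal_prod.prod[OF this, of ?R] show "Poly_Mapping.single m (expo f m) \<in> ideal_prod ?R (?I t) (?I 1)"
          by (simp add: mpoly_ring_ops mult_single ab(1))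
      qed
    qed
  qed
  finally show ?case .
qed

section \<open>Initial monomials and monomial primes\<close>

text \<open>
  Weights add up under multiplication, but products of monomials of least weight might cancel. This
  cannot happen to the product of the two that are smallest for the linear order of the exponent
  vectors, because no other pair of monomials has the same product.
\<close>

lemma initial_monomials:
  fixes f g :: "'k::idom mpoly"
  assumes "f \<noteq> 0" "g \<noteq> 0"
  obtains u v where "u \<in> Poly_Mapping.keys f" "v \<in> Poly_Mapping.keys g"
    "\<And>u'. u' \<in> Poly_Mapping.keys f \<Longrightarrow> weight C u \<le> weight C u'"
    "\<And>v'. v' \<in> Poly_Mapping.keys g \<Longrightarrow> weight C v \<le> weight C v'"
    "u + v \<in> Poly_Mapping.keys (f * g)"
proof -
  have init: "\<exists>u\<in>Poly_Mapping.keys h. \<forall>u'\<in>Poly_Mapping.keys h.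
      weight C u \<le> weight C u' \<and> (weight C u' = weight C u \<longrightarrow> u \<le> u')"
    if "h \<noteq> 0" for h :: "'k mpoly"
  proof -
    define U where
      "U = {u \<in> Poly_Mapping.keys h. \<forall>u'\<in>Poly_Mapping.keys h. weight C u \<le> weight C u'}"
    have "Poly_Mapping.keys h \<noteq> {}"
      using that by (metis in_keys_iff empty_iff poly_mapping_eqI lookup_zero)
    then obtain u0 where "u0 \<in> Poly_Mapping.keys h" by blast
    then have "U \<noteq> {}"
      using ex_has_least_nat[of "\<lambda>u. u \<in> Poly_Mapping.keys h" u0 "weight C"] unfolding U_def by blast
    moreover have "finite U" by (simp add: U_def)
    ultimately have "Min U \<in> U" "\<And>u'. u' \<in> U \<Longrightarrow> Min U \<le> u'" by simp_all
    then obtain u where u: "u \<in> U" "\<And>u'. u' \<in> U \<Longrightarrow> u \<le> u'" by blast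
    moreover have "u' \<in> U" if "u' \<in> Poly_Mapping.keys h" "weight C u' = weight C u" for u'
      using that u(1) unfolding U_def by simp
    ultimately show ?thesis unfolding U_def by blast
  qed
  obtain u where u: "u \<in> Poly_Mapping.keys f"
    "\<And>u'. u' \<in> Poly_Mapping.keys f \<Longrightarrow> weight C u \<le> weight C u'"
    "\<And>u'. u' \<in> Poly_Mapping.keys f \<Longrightarrow> weight C u' = weight C u \<Longrightarrow> u \<le> u'"
    using init[OF assms(1)] by blast
  obtain v where v: "v \<in> Poly_Mapping.keys g"
    "\<And>v'. v' \<in> Poly_Mapping.keys g \<Longrightarrow> weight C v \<le> weight C v'"
    "\<And>v'. v' \<in> Poly_Mapping.keys g \<Longrightarrow> weight C v' = weight C v \<Longrightarrow> v \<le> v'"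
    using init[OF assms(2)] by blast
  have unique: "a = u \<and> b = v"
    if "a \<in> Poly_Mapping.keys f" "b \<in> Poly_Mapping.keys g" "a + b = u + v" for a b
  proof -
    have "weight C a + weight C b = weight C u + weight C v"
      using that(3) by (metis weight_add)
    then have "weight C a = weight C u" "weight C b = weight C v"
      using u(2)[OF that(1)] v(2)[OF that(2)] by linarith+
    then have le: "u \<le> a" "v \<le> b" using u(3)[OF that(1)] v(3)[OF that(2)] by blast+
    have "\<not> u < a" using add_less_le_mono[OF _ le(2), of u a] that(3) by auto
    moreover have "\<not> v < b" using add_le_less_mono[OF le(1), of v b] that(3) by auto
    ultimately show ?thesis using le unfolding le_less by blast
  qed
  define f' where "f' = f - Poly_Mapping.single u (expo f u)"
  define g' where "g' = g - Poly_Mapping.single v (expo g v)"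
  have keys': "Poly_Mapping.keys f' \<subseteq> Poly_Mapping.keys f - {u}"
    "Poly_Mapping.keys g' \<subseteq> Poly_Mapping.keys g - {v}"
    by (auto simp: f'_def g'_def in_keys_iff lookup_minus lookup_single when_def split: if_splits)
  have "f * g = Poly_Mapping.single (u + v) (expo f u * expo g v)
      + Poly_Mapping.single u (expo f u) * g' + f' * g"
    unfolding f'_def g'_def mult_single[symmetric] by (simp add: algebra_simps)
  moreover have "u + v \<notin> Poly_Mapping.keys (f' * g)"
  proof
    assume "u + v \<in> Poly_Mapping.keys (f' * g)"
    then obtain a b where "u + v = a + b" "a \<in> Poly_Mapping.keys f'" "b \<in> Poly_Mapping.keys g"
      by (rule keys_multE)
    then show False using unique[of a b] keys'(1) by auto
  qed
  moreover have "u + v \<notin> Poly_Mapping.keys (Poly_Mapping.single u (expo f u) * g')"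
  proof
    assume "u + v \<in> Poly_Mapping.keys (Poly_Mapping.single u (expo f u) * g')"
    then obtain a b where "u + v = a + b" "a \<in> Poly_Mapping.keys (Poly_Mapping.single u (expo f u))"
      "b \<in> Poly_Mapping.keys g'"
      by (rule keys_multE)
    then show False using unique[of a b] keys'(2) u(1) by (auto split: if_splits)
  qed
  ultimately have "expo (f * g) (u + v) = expo f u * expo g v"
    by (simp add: lookup_add in_keys_iff)
  then have "u + v \<in> Poly_Mapping.keys (f * g)" using u(1) v(1) by (simp add: in_keys_iff)
  then show ?thesis using that u v by blast
qed

text \<open>
  For the prime generated by the variables in \<open>C\<close>, the \<open>t\<close>-th power consists of the polynomials
  whose monomials have weight at least \<open>t\<close> on \<open>C\<close>. It is primary: a polynomial outside the prime has a
  monomial of weight \<open>0\<close>, so multiplication by it does not raise the least weight.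
\<close>

lemma weight_monomial_ideal_saturated:
  fixes f s :: "'k::idom mpoly"
  assumes "f \<in> carrier (mpoly_ring n)" "s \<in> carrier (mpoly_ring n)"
    and "s \<notin> monomial_ideal n (\<lambda>m. 1 \<le> weight C m)"
    and "s * f \<in> monomial_ideal n (\<lambda>m. t \<le> weight C m)"
  shows "f \<in> monomial_ideal n (\<lambda>m. t \<le> weight C m)"
proof (cases "f = 0")
  case False
  obtain z where z: "z \<in> Poly_Mapping.keys s" "weight C z = 0"
    using assms(2,3) by (auto simp: monomial_ideal_def not_le)
  then have "s \<noteq> 0" by auto
  from initial_monomials[OF this False, of C] obtain u v where
    uv: "u \<in> Poly_Mapping.keys s" "\<And>u'. u' \<in> Poly_Mapping.keys s \<Longrightarrow> weight C u \<le> weight C u'"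
    "\<And>v'. v' \<in> Poly_Mapping.keys f \<Longrightarrow> weight C v \<le> weight C v'"
    "u + v \<in> Poly_Mapping.keys (s * f)" by metis
  have "t \<le> weight C u + weight C v"
    using assms(4) uv(4) unfolding monomial_ideal_def by (auto simp: weight_add)
  moreover have "weight C u = 0" using uv(2)[OF z(1)] z(2) by simp
  ultimately show ?thesis using uv(3) assms(1) unfolding monomial_ideal_def by fastforce
qed (simp add: monomial_ideal_def mpoly_carrier_iff)

lemma ideal_weight_monomial_ideal:
  "ideal (monomial_ideal n (\<lambda>m. t \<le> weight C m)) (mpoly_ring n)"
  by (rule ideal_monomial_ideal) (simp add: weight_add)

lemma primeideal_weight_monomial_ideal:
  "primeideal (monomial_ideal n (\<lambda>m. 1 \<le> weight C m) :: 'k::idom mpoly set) (mpoly_ring n)"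
proof (rule primeidealI[OF ideal_weight_monomial_ideal cring_mpoly_ring])
  have "(1 :: 'k mpoly) \<in> carrier (mpoly_ring n)" by (simp add: mpoly_carrier_iff)
  moreover have "(1 :: 'k mpoly) \<notin> monomial_ideal n (\<lambda>m. 1 \<le> weight C m)"
    by (simp add: monomial_ideal_def)
  ultimately show "carrier (mpoly_ring n) \<noteq> (monomial_ideal n (\<lambda>m. 1 \<le> weight C m) :: 'k mpoly set)"
    by blast
next
  fix a b :: "'k mpoly"
  assume ab: "a \<in> carrier (mpoly_ring n)" "b \<in> carrier (mpoly_ring n)"
    "a \<otimes>\<^bsub>mpoly_ring n\<^esub> b \<in> monomial_ideal n (\<lambda>m. 1 \<le> weight C m)"
  then show "a \<in> monomial_ideal n (\<lambda>m. 1 \<le> weight C m) \<or> b \<in> monomial_ideal n (\<lambda>m. 1 \<le> weight C m)"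
    using weight_monomial_ideal_saturated[OF ab(2,1), of C 1] unfolding mpoly_ring_ops by blast
qed

section \<open>Localisation and symbolic powers\<close>

text \<open>
  The fractions with numerator in \<open>J\<close> and denominator outside \<open>P\<close> form an ideal of the localization,
  which is therefore the extension of \<open>J\<close>.
\<close>

lemma mem_extension_iff:
  fixes P J :: "'k::field mpoly set"
  assumes P: "primeideal P (mpoly_ring n)" and J: "ideal J (mpoly_ring n)"
    and f: "f \<in> carrier (mpoly_ring n)"
  shows "Fract f 1 \<in> extension n P J \<longleftrightarrow> (\<exists>s\<in>carrier (mpoly_ring n) - P. s * f \<in> J)"
proof -
  let ?S = "carrier (mpoly_ring n) :: 'k mpoly set"
  interpret P: primeideal P "mpoly_ring n" by (rule P)
  define L where "L = {Fract f s | f s. f \<in> ?S \<and> s \<in> ?S - P}"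
  have L_I: "Fract f s \<in> L" if "f \<in> ?S" "s \<in> ?S - P" for f s
    using that unfolding L_def by blast
  have loc: "localization n P = type_subring L" by (simp add: localization_def L_def)
  have one: "1 \<in> ?S - P"
    using P.I_notcarr P.one_imp_carrier P.one_closed by (auto simp: mpoly_ring_ops)
  have mult: "s * s' \<in> ?S - P" if "s \<in> ?S - P" "s' \<in> ?S - P" for s s'
    using that P.I_prime[of s s'] mpoly_carrier_closed(2) by (auto simp: mpoly_ring_ops)
  have nz: "s \<noteq> 0" if "s \<in> ?S - P" for s
    using that additive_subgroup.zero_closed[OF P.is_additive_subgroup] by (auto simp: mpoly_ring_ops)
  have Jcl: "J \<subseteq> ?S" "0 \<in> J" "\<And>x y. x \<in> J \<Longrightarrow> y \<in> J \<Longrightarrow> x + y \<in> J"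
    "\<And>r x. r \<in> ?S \<Longrightarrow> x \<in> J \<Longrightarrow> r * x \<in> J"
    using J by (auto simp: ideal_mpoly_ring)
  have neg: "- x \<in> ?S" if "x \<in> ?S" for x :: "'k mpoly"
    using that by (simp add: mpoly_carrier_iff in_keys_iff)
  have "cring (type_subring L)"
  proof (rule cring_type_subring)
    show "1 \<in> L" using one by (auto simp: L_def One_fract_def)
  next
    fix x y assume "x \<in> L" "y \<in> L"
    then obtain a s b u where xy: "x = Fract a s" "y = Fract b u"
      and mem: "a \<in> ?S" "b \<in> ?S" "s \<in> ?S - P" "u \<in> ?S - P" unfolding L_def by blast
    have "x + y = Fract (a * u + b * s) (s * u)" "x * y = Fract (a * b) (s * u)"
      unfolding xy using nz[OF mem(3)] nz[OF mem(4)] by simp_all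
    moreover have "a * u + b * s \<in> ?S" "a * b \<in> ?S"
      by (intro mpoly_carrier_closed; use mem in blast)+
    ultimately show "x + y \<in> L" "x * y \<in> L"
      using L_I mult[OF mem(3,4)] by simp_all
  next
    fix x assume "x \<in> L"
    then obtain a s where "x = Fract a s" "a \<in> ?S" "s \<in> ?S - P" unfolding L_def by blast
    then show "- x \<in> L" using neg unfolding L_def by auto
  qed
  note ideal_L = ideal_type_subring[OF this]
  show ?thesis
  proof
    assume ext: "Fract f 1 \<in> extension n P J"
    define K where "K = {Fract a s | a s. a \<in> J \<and> s \<in> ?S - P}"
    have "ideal K (type_subring L)"
      unfolding ideal_L
    proof (intro conjI ballI)
      show "K \<subseteq> L" using Jcl(1) unfolding K_def L_def by blast
      show "0 \<in> K" using one Jcl(2) by (auto simp: K_def Zero_fract_def)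
    next
      fix x y assume "x \<in> K" "y \<in> K"
      then obtain a s b u where xy: "x = Fract a s" "y = Fract b u"
        and mem: "a \<in> J" "b \<in> J" "s \<in> ?S - P" "u \<in> ?S - P" unfolding K_def by blast
      have "x + y = Fract (u * a + s * b) (s * u)"
        unfolding xy using nz[OF mem(3)] nz[OF mem(4)] by (simp add: mult.commute)
      moreover have "u * a + s * b \<in> J" using mem Jcl by simp
      ultimately show "x + y \<in> K" using mult[OF mem(3,4)] unfolding K_def by blast
    next
      fix r x assume "r \<in> L" "x \<in> K"
      then obtain a s b u where rx: "r = Fract a s" "x = Fract b u"
        and mem: "a \<in> ?S" "b \<in> J" "s \<in> ?S - P" "u \<in> ?S - P" unfolding L_def K_def by blast
      have "r * x = Fract (a * b) (s * u)" unfolding rx by simp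
      moreover have "a * b \<in> J" using mem Jcl by simp
      ultimately show "r * x \<in> K" using mult[OF mem(3,4)] unfolding K_def by blast
    qed
    moreover have "(\<lambda>f. Fract f 1) ` J \<subseteq> K" using one unfolding K_def by blast
    ultimately have "Fract f 1 \<in> K"
      using ext unfolding extension_def genideal_def loc by blast
    then obtain a s where a: "Fract f 1 = Fract a s" "a \<in> J" "s \<in> ?S - P" unfolding K_def by blast
    then have "s * f = a" using nz[OF a(3)] by (simp add: eq_fract mult.commute)
    then show "\<exists>s\<in>?S - P. s * f \<in> J" using a by blast
  next
    assume "\<exists>s\<in>?S - P. s * f \<in> J"
    then obtain s where s: "s \<in> ?S - P" "s * f \<in> J" by blast
    show "Fract f 1 \<in> extension n P J"
      unfolding extension_def genideal_def loc
    proof (intro InterI, clarify)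
      fix K assume K: "ideal K (type_subring L)" "(\<lambda>f. Fract f 1) ` J \<subseteq> K"
      have "Fract 1 s \<in> L" using one s(1) unfolding L_def by blast
      moreover have "Fract (s * f) 1 \<in> K" using K(2) s(2) by blast
      ultimately have "Fract 1 s * Fract (s * f) 1 \<in> K" using K(1) unfolding ideal_L by blast
      then show "Fract f 1 \<in> K" using nz[OF s(1)] mult_fract_cancel[of s f 1] by simp
    qed
  qed
qed

lemma mem_symbolic_power_iff:
  fixes I :: "'k::field mpoly set"
  assumes "ideal (ideal_power (mpoly_ring n) I t) (mpoly_ring n)"
  shows "f \<in> symbolic_power n I t \<longleftrightarrow> f \<in> carrier (mpoly_ring n) \<and>
    (\<forall>P\<in>associated_primes (mpoly_ring n) (quot_module (mpoly_ring n) (carrier (mpoly_ring n)) I).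
       \<exists>s\<in>carrier (mpoly_ring n) - P. s * f \<in> ideal_power (mpoly_ring n) I t)"
proof -
  have "primeideal P (mpoly_ring n)"
    if "P \<in> associated_primes (mpoly_ring n) (quot_module (mpoly_ring n) (carrier (mpoly_ring n)) I)" for P
    using that by (simp add: associated_primes_def)
  then show ?thesis
    unfolding symbolic_power_def using mem_extension_iff[OF _ assms] by blast
qed

section \<open>Symbolic powers of edge ideals\<close>

text \<open>
  The exponent vector of the \<open>k\<close>-th power of the product of the variables in \<open>S\<close>.
\<close>

definition const_monomial :: "'a set \<Rightarrow> nat \<Rightarrow> ('a \<Rightarrow>\<^sub>0 nat)" where
  "const_monomial S k = (\<Sum>j\<in>S. Poly_Mapping.single j k)"

lemma lookup_const_monomial:
  "finite S \<Longrightarrow> expo (const_monomial S k) i = (if i \<in> S then k else 0)"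
  unfolding const_monomial_def lookup_sum by (simp add: lookup_single when_def)

lemma lookup_times_monomial:
  fixes f :: "'k::comm_ring_1 mpoly"
  shows "expo (f * Poly_Mapping.single m 1) (u + m) = expo f u"
proof -
  have "f * Poly_Mapping.single m 1 = (\<Sum>v\<in>Poly_Mapping.keys f. Poly_Mapping.single (v + m) (expo f v))"
    by (subst poly_eq_sum_monomials[of f]) (simp add: sum_distrib_right mult_single)
  also have "expo \<dots> (u + m) = (\<Sum>v\<in>Poly_Mapping.keys f. if v = u then expo f v else 0)"
    unfolding lookup_sum by (rule sum.cong) (auto simp: lookup_single when_def)
  also have "\<dots> = expo f u" by (simp add: in_keys_iff)
  finally show ?thesis .
qed

lemma keys_times_monomial:
  fixes f :: "'k::comm_ring_1 mpoly"
  shows "Poly_Mapping.keys (f * Poly_Mapping.single m 1) = (\<lambda>u. u + m) ` Poly_Mapping.keys f"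
proof
  show "(\<lambda>u. u + m) ` Poly_Mapping.keys f \<subseteq> Poly_Mapping.keys (f * Poly_Mapping.single m 1)"
    by (auto simp: in_keys_iff lookup_times_monomial)
  show "Poly_Mapping.keys (f * Poly_Mapping.single m 1) \<subseteq> (\<lambda>u. u + m) ` Poly_Mapping.keys f"
  proof
    fix x assume "x \<in> Poly_Mapping.keys (f * Poly_Mapping.single m 1)"
    then obtain a b where "x = a + b" "a \<in> Poly_Mapping.keys f"
      "b \<in> Poly_Mapping.keys (Poly_Mapping.single m (1::'k))" by (rule keys_multE)
    then show "x \<in> (\<lambda>u. u + m) ` Poly_Mapping.keys f" by auto
  qed
qed

lemma packs_1_iff:
  assumes "simple_graph V E"
  shows "packs E 1 m \<longleftrightarrow> (\<exists>i j. {i, j} \<in> E \<and> expo m i > 0 \<and> expo m j > 0)"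
proof
  assume "packs E 1 m"
  then have "packs E (Suc 0) m" by simp
  then obtain i j q where "{i, j} \<in> E" "m = Poly_Mapping.single i 1 + Poly_Mapping.single j 1 + q"
    by (rule packs_SucE)
  then show "\<exists>i j. {i, j} \<in> E \<and> expo m i > 0 \<and> expo m j > 0"
    by (intro exI[of _ i] exI[of _ j]) (auto simp: lookup_add)
next
  assume "\<exists>i j. {i, j} \<in> E \<and> expo m i > 0 \<and> expo m j > 0"
  then obtain i j where e: "{i, j} \<in> E" "expo m i > 0" "expo m j > 0" by blast
  then obtain q where m: "m = Poly_Mapping.single i 1 + Poly_Mapping.single j 1 + q"
    using split_off_edge simple_graph_edgeD(3)[OF assms e(1)] by metis
  show "packs E 1 m" unfolding m by (rule packs_multiple[OF packs_edge[OF e(1)]])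
qed

lemma vertex_coverD: "vertex_cover V E C \<Longrightarrow> {i, j} \<in> E \<Longrightarrow> i \<in> C \<or> j \<in> C"
  unfolding vertex_cover_def by (drule conjunct2, drule bspec, assumption) simp

lemma packs_weight_cover:
  assumes "vertex_cover V E C" "finite V" "packs E t m"
  shows "t \<le> weight C m"
  using assms(3)
proof (induction t arbitrary: m)
  case (Suc t)
  from Suc.prems obtain i j q where e: "{i, j} \<in> E" "packs E t q"
    and m: "m = Poly_Mapping.single i 1 + Poly_Mapping.single j 1 + q" by (rule packs_SucE)
  have "finite C" using assms(1,2) unfolding vertex_cover_def by (meson finite_subset)
  moreover have "i \<in> C \<or> j \<in> C" by (rule vertex_coverD[OF assms(1) e(1)])
  ultimately have "1 \<le> weight C (Poly_Mapping.single i 1) + weight C (Poly_Mapping.single j 1)"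
    by (auto simp: weight_single)
  then show ?case unfolding m weight_add using Suc.IH[OF e(2)] by linarith
qed simp

text \<open>
  The prime of a minimal cover \<open>C\<close> is the annihilator of the product of all variables outside \<open>C\<close>:
  by minimality every vertex of \<open>C\<close> lies on an edge whose other end is outside \<open>C\<close>.
\<close>

lemma minimal_cover_prime_associated:
  assumes G: "simple_graph {1..n} E" and C: "vertex_cover {1..n} E C"
    and minimal: "\<And>D. D \<subset> C \<Longrightarrow> \<not> vertex_cover {1..n} E D"
  shows "(monomial_ideal n (\<lambda>m. 1 \<le> weight C m) :: 'k::field mpoly set)
    \<in> associated_primes (mpoly_ring n)
        (quot_module (mpoly_ring n) (carrier (mpoly_ring n)) (edge_ideal n E))"
proof -
  define x where "x = const_monomial ({1..n} - C) 1"
  have lx: "expo x i = (if i \<in> {1..n} - C then 1 else 0)" for i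
    unfolding x_def by (simp add: lookup_const_monomial)
  have "finite C" using C unfolding vertex_cover_def by (meson finite_atLeastAtMost finite_subset)
  \<comment> \<open>Multiplying a monomial by all variables outside \<open>C\<close> completes an edge exactly if the monomial meets \<open>C\<close>.\<close>
  have key: "packs E 1 (m + x) \<longleftrightarrow> 1 \<le> weight C m" for m
  proof
    assume "packs E 1 (m + x)"
    then obtain i j where e: "{i, j} \<in> E" "expo (m + x) i > 0" "expo (m + x) j > 0"
      using packs_1_iff[OF G] by blast
    then obtain k where "k \<in> C" "expo m k > 0"
      using C unfolding vertex_cover_def by (fastforce simp: lookup_add lx)
    then show "1 \<le> weight C m" using \<open>finite C\<close> member_le_sum[of k C "expo m"] by simp
  next
    assume "1 \<le> weight C m"
    then obtain i where i: "i \<in> C" "expo m i > 0"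
      by (metis gr0I not_one_le_zero sum.neutral)
    have "\<not> vertex_cover {1..n} E (C - {i})" using minimal i(1) by blast
    then obtain e where e: "e \<in> E" "e \<inter> (C - {i}) = {}"
      using C unfolding vertex_cover_def by blast
    then have "i \<in> e" using C unfolding vertex_cover_def by blast
    moreover obtain u v where uv: "e = {u, v}" "u \<in> {1..n}" "v \<in> {1..n}" "u \<noteq> v"
      using G e(1) unfolding simple_graph_def by auto
    ultimately obtain j where j: "e = {i, j}" "j \<in> {1..n}" "j \<noteq> i" by auto
    then have "j \<notin> C" using e(2) by blast
    then show "packs E 1 (m + x)"
      unfolding packs_1_iff[OF G] using i j e(1) by (intro exI[of _ i] exI[of _ j]) (auto simp: lookup_add lx)
  qed
  have "Poly_Mapping.keys x \<subseteq> {1..n}" by (auto simp: in_keys_iff lx split: if_splits)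
  then have x_carr: "Poly_Mapping.single x 1 \<in> carrier (mpoly_ring n :: 'k mpoly ring)"
    by (rule single_in_mpoly_carrier)
  have "(monomial_ideal n (\<lambda>m. 1 \<le> weight C m) :: 'k mpoly set) =
      {r \<in> carrier (mpoly_ring n). r \<otimes>\<^bsub>mpoly_ring n\<^esub> Poly_Mapping.single x 1 \<in> edge_ideal n E}"
    using mpoly_carrier_closed(2)[OF _ x_carr] unfolding edge_ideal_eq[OF G] mpoly_ring_ops
    by (auto simp add: monomial_ideal_def keys_times_monomial key simp del: One_nat_def)
  moreover have "ideal (edge_ideal n E :: 'k mpoly set) (mpoly_ring n)"
    unfolding edge_ideal_eq[OF G] by (rule ideal_monomial_ideal_packs)
  ultimately show ?thesis
    using x_carr primeideal_weight_monomial_ideal[of n C]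
    by (subst associated_primes_quot_module) blast+
qed

lemma ideal_power_edge_ideal:
  assumes "simple_graph {1..n} E"
  shows "ideal_power (mpoly_ring n) (edge_ideal n E) t = (monomial_ideal n (packs E t) :: 'k::comm_ring_1 mpoly set)"
  unfolding edge_ideal_eq[OF assms] by (rule ideal_power_eq)

text \<open>
  Localizing at the prime of a minimal cover inside \<open>C\<close> gives the bound for that cover, because the
  powers of this prime are primary.
\<close>

lemma symbolic_power_weight:
  fixes f :: "'k::field mpoly"
  assumes G: "simple_graph {1..n} E" and f: "f \<in> symbolic_power n (edge_ideal n E) t"
    and C: "vertex_cover {1..n} E C" and m: "m \<in> Poly_Mapping.keys f"
  shows "t \<le> weight C m"
proof -
  obtain D where D: "vertex_cover {1..n} E D" "D \<subseteq> C"
    and least: "\<And>D'. vertex_cover {1..n} E D' \<and> D' \<subseteq> C \<Longrightarrow> card D \<le> card D'"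
    using ex_has_least_nat[of "\<lambda>D. vertex_cover {1..n} E D \<and> D \<subseteq> C" C card] C by blast
  have fin: "finite C" using C unfolding vertex_cover_def by (meson finite_atLeastAtMost finite_subset)
  have minimal: "\<not> vertex_cover {1..n} E D'" if "D' \<subset> D" for D'
    using least[of D'] psubset_card_mono[OF finite_subset[OF D(2) fin] that] that D(2) by fastforce
  let ?P = "monomial_ideal n (\<lambda>m. 1 \<le> weight D m) :: 'k mpoly set"
  have "ideal (ideal_power (mpoly_ring n) (edge_ideal n E :: 'k mpoly set) t) (mpoly_ring n)"
    unfolding ideal_power_edge_ideal[OF G] by (rule ideal_monomial_ideal_packs)
  from f[unfolded mem_symbolic_power_iff[OF this]] minimal_cover_prime_associated[OF G D(1) minimal, where 'k='k]
  obtain s where s: "s \<in> carrier (mpoly_ring n)" "s \<notin> ?P"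
    "s * f \<in> monomial_ideal n (packs E t)" and fc: "f \<in> carrier (mpoly_ring n)"
    unfolding ideal_power_edge_ideal[OF G] by blast
  have "s * f \<in> monomial_ideal n (\<lambda>m. t \<le> weight D m)"
    using s(3) packs_weight_cover[OF D(1)] unfolding monomial_ideal_def by auto
  from weight_monomial_ideal_saturated[OF fc s(1,2) this] m have "t \<le> weight D m"
    unfolding monomial_ideal_def by blast
  also have "\<dots> \<le> weight C m" using D(2) fin by (intro sum_mono2) auto
  finally show ?thesis .
qed

text \<open>
  The edge ideal is the intersection of the primes of the vertex covers.
\<close>

lemma edge_ideal_radical:
  fixes g :: "'k::field mpoly"
  assumes G: "simple_graph {1..n} E" and g: "g \<in> carrier (mpoly_ring n)" "g * g \<in> edge_ideal n E"
  shows "g \<in> edge_ideal n E"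
proof (rule ccontr)
  \<comment> \<open>A monomial of \<open>g\<close> outside the edge ideal is avoided by some vertex cover.\<close>
  assume "g \<notin> edge_ideal n E"
  then obtain m where m: "m \<in> Poly_Mapping.keys g" "\<not> packs E 1 m"
    using g(1) unfolding edge_ideal_eq[OF G] monomial_ideal_def by blast
  define C where "C = {1..n} - Poly_Mapping.keys m"
  have "e \<inter> C \<noteq> {}" if "e \<in> E" for e
  proof -
    have "\<exists>u v. e = {u, v} \<and> u \<in> {1..n} \<and> v \<in> {1..n}"
      using G that unfolding simple_graph_def by blast
    then obtain u v where uv: "e = {u, v}" "u \<in> {1..n}" "v \<in> {1..n}" by blast
    then have "u \<notin> Poly_Mapping.keys m \<or> v \<notin> Poly_Mapping.keys m"
      using m(2) that unfolding packs_1_iff[OF G] by (metis in_keys_iff gr0I)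
    then show ?thesis using uv unfolding C_def by blast
  qed
  then have C: "vertex_cover {1..n} E C" unfolding vertex_cover_def C_def by auto
  have "weight C m = 0" by (rule sum.neutral) (simp add: C_def in_keys_iff)
  then have "g \<notin> monomial_ideal n (\<lambda>m. 1 \<le> weight C m)"
    using m(1) by (force simp: monomial_ideal_def)
  moreover have "g * g \<in> monomial_ideal n (\<lambda>m. 1 \<le> weight C m)"
    using g(2) packs_weight_cover[OF C] unfolding edge_ideal_eq[OF G] monomial_ideal_def by auto
  ultimately show False using weight_monomial_ideal_saturated[OF g(1,1)] by blast
qed

section \<open>Edges and triangles\<close>

definition triangle :: "'v set set \<Rightarrow> 'v \<Rightarrow> 'v \<Rightarrow> 'v \<Rightarrow> bool" where
  "triangle E a b c \<longleftrightarrow> {a, b} \<in> E \<and> {b, c} \<in> E \<and> {a, c} \<in> E"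

definition closed_nbhd :: "'v set set \<Rightarrow> 'v set \<Rightarrow> 'v set" where
  "closed_nbhd E T = T \<union> {i. \<exists>v\<in>T. {i, v} \<in> E}"

text \<open>
  Delete \<open>W\<close> and its neighbours. The rest contains no triangle, as every triangle meets \<open>W\<close> or is
  adjacent to it, and no odd hole, so it is bipartite. It remains bipartite when the edges
  between \<open>W\<close> and its neighbours are put back. A cover of this smaller graph either contains a vertex
  of \<open>W\<close>, which alone has weight at least \<open>t\<close>, or contains all neighbours of \<open>W\<close> and then covers all
  of \<open>E\<close>. Koenig's theorem for the smaller graph thus provides the packing.
\<close>

lemma packs_if_triangles_near_independent_set:
  assumes G: "simple_graph V E" and holes: "\<And>k. odd k \<Longrightarrow> k \<ge> 5 \<Longrightarrow> \<not> has_induced_cycle V E k"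
    and W: "W \<subseteq> V" "\<And>i j. i \<in> W \<Longrightarrow> j \<in> W \<Longrightarrow> {i, j} \<notin> E"
    and near: "\<And>a b c. triangle E a b c \<Longrightarrow> closed_nbhd E {a, b, c} \<inter> W \<noteq> {}"
    and m: "\<And>C. vertex_cover V E C \<Longrightarrow> t \<le> weight C m"
  shows "packs E t (m + const_monomial W t)"
proof -
  have fin: "finite V" using G by (simp add: simple_graph_def)
  have edge: "\<exists>u v. e = {u, v} \<and> u \<in> V \<and> v \<in> V \<and> u \<noteq> v" if "e \<in> E" for e
    using G that unfolding simple_graph_def by blast
  define N where "N = {v. \<exists>w\<in>W. {v, w} \<in> E}"
  define U where "U = V - W - N"
  define EU where "EU = {e \<in> E. e \<subseteq> U}"
  define E' where "E' = EU \<union> {e \<in> E. e \<inter> W \<noteq> {}}"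
  have GU: "simple_graph U EU"
    using edge fin unfolding simple_graph_def EU_def by (auto simp: U_def) blast
  have no_cycle: "\<not> has_induced_cycle U EU k" if "odd k" for k
  proof
    assume "has_induced_cycle U EU k"
    then obtain c where c: "3 \<le> k" "length c = k" "distinct c" "set c \<subseteq> U"
      "\<forall>i<k. \<forall>j<k. {c ! i, c ! j} \<in> EU \<longleftrightarrow> j = Suc i mod k \<or> i = Suc j mod k"
      unfolding has_induced_cycle_def by blast
    have "{c ! i, c ! j} \<in> EU \<longleftrightarrow> {c ! i, c ! j} \<in> E" if "i < k" "j < k" for i j
      using c(2,4) that nth_mem[of i c] nth_mem[of j c] unfolding EU_def by auto
    then have c': "\<forall>i<k. \<forall>j<k. {c ! i, c ! j} \<in> E \<longleftrightarrow> j = Suc i mod k \<or> i = Suc j mod k"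
      using c(5) by blast
    have "U \<subseteq> V" by (auto simp: U_def)
    then have "has_induced_cycle V E k"
      unfolding has_induced_cycle_def using c(1-4) c' by blast
    then have "\<not> 5 \<le> k" using holes[OF \<open>odd k\<close>] by blast
    then have "k = 3" using c(1) \<open>odd k\<close> by presburger
    then have "triangle E (c ! 0) (c ! 1) (c ! 2)"
      using c'[rule_format, of 0 1] c'[rule_format, of 1 2] c'[rule_format, of 0 2]
      unfolding triangle_def by simp
    moreover have "c ! 0 \<in> U" "c ! 1 \<in> U" "c ! 2 \<in> U" using c(2,4) \<open>k = 3\<close> by auto
    ultimately show False using near[of "c ! 0" "c ! 1" "c ! 2"]
      unfolding closed_nbhd_def U_def N_def by (auto simp: insert_commute)
  qed
  obtain A where A: "\<And>u v. {u, v} \<in> EU \<Longrightarrow> (u \<in> A) \<noteq> (v \<in> A)"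
    using bipartite_if_no_induced_odd_cycle[OF GU no_cycle] by blast
  have "E' \<subseteq> E" by (auto simp: E'_def EU_def)
  then have G': "simple_graph V E'" using G unfolding simple_graph_def by blast
  have W_edge: "v \<in> N \<and> v \<notin> W" if "u \<in> W" "{u, v} \<in> E" for u v
    using that W(2) unfolding N_def by (auto simp: insert_commute)
  have bip: "(u \<in> W \<union> (A \<inter> U)) \<noteq> (v \<in> W \<union> (A \<inter> U))" if e: "{u, v} \<in> E'" for u v
  proof -
    consider "{u, v} \<in> EU" | "u \<in> W" "{u, v} \<in> E" | "v \<in> W" "{v, u} \<in> E"
      using e unfolding E'_def by (auto simp: insert_commute)
    then show ?thesis
    proof cases
      case 1
      then have "u \<in> U" "v \<in> U" by (auto simp: EU_def)
      then show ?thesis using A[OF 1] by (auto simp: U_def)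
    next
      case 2
      then show ?thesis using W_edge[OF 2] by (auto simp: U_def)
    next
      case 3
      then show ?thesis using W_edge[OF 3] by (auto simp: U_def)
    qed
  qed
  have "packs E' t (m + const_monomial W t)"
  proof (rule bipartite_packing[OF G' bip])
    fix C assume C: "vertex_cover V E' C"
    have finC: "finite C" "finite W" using C W(1) fin unfolding vertex_cover_def by (meson finite_subset)+
    show "t \<le> weight C (m + const_monomial W t)"
    proof (cases "C \<inter> W = {}")
      case True
      have "e \<inter> C \<noteq> {}" if e: "e \<in> E" for e
      proof (cases "e \<in> E'")
        case True
        then show ?thesis using C unfolding vertex_cover_def by blast
      next
        case False
        then have "e \<inter> W = {}" "\<not> e \<subseteq> U" using e unfolding E'_def EU_def by blast+
        moreover have "e \<subseteq> V" using edge[OF e] by auto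
        ultimately obtain x where x: "x \<in> e" "x \<in> N" unfolding U_def by blast
        then obtain w where w: "w \<in> W" "{x, w} \<in> E" unfolding N_def by blast
        then have "{x, w} \<inter> C \<noteq> {}" using C unfolding vertex_cover_def E'_def by blast
        then show ?thesis using x(1) w(1) True \<open>C \<inter> W = {}\<close> by auto
      qed
      then have "vertex_cover V E C" using C unfolding vertex_cover_def by blast
      then show ?thesis using m by (simp add: weight_add trans_le_add1)
    next
      case False
      then obtain w where w: "w \<in> C" "w \<in> W" by blast
      then have "t \<le> weight C (const_monomial W t)"
        using member_le_sum[of w C "expo (const_monomial W t)"] finC by (simp add: lookup_const_monomial)
      then show ?thesis by (simp add: weight_add)
    qed
  qed
  then show ?thesis using \<open>E' \<subseteq> E\<close> by (rule packs_mono)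
qed

text \<open>
  If all edges supported by \<open>m\<close> lie inside \<open>T\<close>, every packed edge uses up two units of weight in \<open>T\<close>.
\<close>

lemma packs_within:
  assumes "finite T" and "\<And>i j. {i, j} \<in> E \<Longrightarrow> expo m i > 0 \<Longrightarrow> expo m j > 0 \<Longrightarrow> i \<in> T \<and> j \<in> T"
    and "packs E t m"
  shows "2 * t \<le> weight T m"
  using assms(2,3)
proof (induction t arbitrary: m)
  case (Suc t)
  from Suc.prems(2) obtain i j q where e: "{i, j} \<in> E" "packs E t q"
    and m: "m = Poly_Mapping.single i 1 + Poly_Mapping.single j 1 + q" by (rule packs_SucE)
  have "i \<in> T \<and> j \<in> T" using Suc.prems(1)[OF e(1)] unfolding m by (simp add: lookup_add)
  then have "weight T m = 2 + weight T q" unfolding m weight_add using assms(1) by (simp add: weight_single)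
  moreover have "2 * t \<le> weight T q"
    using Suc.prems(1) by (intro Suc.IH e(2)) (auto simp: m lookup_add)
  ultimately show ?case by simp
qed simp

text \<open>
  The exponent vector of \<open>(x\<^sub>a x\<^sub>b)\<^sup>k x\<^sub>a x\<^sub>b x\<^sub>c\<close>. For \<open>k = t - 2\<close> its degree is \<open>2 t - 1\<close>, one less than the
  degree of the generators of the ordinary \<open>t\<close>-th power.
\<close>

definition triangle_monomial :: "'v \<Rightarrow> 'v \<Rightarrow> 'v \<Rightarrow> nat \<Rightarrow> ('v \<Rightarrow>\<^sub>0 nat)" where
  "triangle_monomial a b c k =
     Poly_Mapping.single a (Suc k) + Poly_Mapping.single b (Suc k) + Poly_Mapping.single c 1"

lemma weight_triangle_monomial: "weight {a, b, c} (triangle_monomial a b c k) = 2 * k + 3"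
  by (simp add: triangle_monomial_def weight_add weight_single del: sum.insert_if)

lemma monomial_ideal_packs_mult:
  fixes f g :: "'k::comm_ring_1 mpoly"
  assumes "f \<in> monomial_ideal n (packs E s)" "g \<in> monomial_ideal n (packs E t)"
  shows "f * g \<in> monomial_ideal n (packs E (s + t))"
proof -
  have "packs E (s + t) m" if "m \<in> Poly_Mapping.keys (f * g)" for m
    using that assms packs_add[of E s _ t] by (elim keys_multE) (auto simp: monomial_ideal_def)
  then show ?thesis using assms mpoly_carrier_closed(2)[of f n g] by (auto simp: monomial_ideal_def)
qed

lemma edge_monomial_power:
  assumes G: "simple_graph {1..n} E" and e: "{i, j} \<in> E"
  shows "(indet i * indet j) ^ k \<in> (monomial_ideal n (packs E k) :: 'k::comm_ring_1 mpoly set)"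
proof (induction k)
  case 0
  show ?case by (simp add: monomial_ideal_def mpoly_carrier_iff)
next
  case (Suc k)
  have "indet i * indet j = (Poly_Mapping.single (Poly_Mapping.single i 1 + Poly_Mapping.single j 1) 1 :: 'k mpoly)"
    by (simp add: indet_def mult_single)
  moreover have "indet i \<in> carrier (mpoly_ring n :: 'k mpoly ring)"
    "indet j \<in> carrier (mpoly_ring n :: 'k mpoly ring)"
    using simple_graph_edgeD[OF G e] by (simp_all add: indet_in_carrier)
  then have "indet i * indet j \<in> carrier (mpoly_ring n :: 'k mpoly ring)"
    by (rule mpoly_carrier_closed)
  ultimately have "indet i * indet j \<in> (monomial_ideal n (packs E 1) :: 'k mpoly set)"
    using packs_edge[OF e] unfolding monomial_ideal_def by simp
  from monomial_ideal_packs_mult[OF this Suc.IH] show ?case by simp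
qed

text \<open>
  An associated prime has the form \<open>P = (I : g)\<close>, and \<open>g\<close> lies outside \<open>P\<close> since \<open>I\<close> is radical. Two of
  the three vertices of the triangle have their variables in \<open>P\<close>, so each of these two variables is
  multiplied into \<open>I\<close> by \<open>g\<close>, and \<open>g\<^sup>2\<close> multiplies the product of the three variables into \<open>I\<^sup>2\<close>. The
  remaining \<open>k\<close> factors are edges.
\<close>

lemma triangle_monomial_symbolic:
  assumes G: "simple_graph {1..n} E" and T: "triangle E a b c"
  shows "(Poly_Mapping.single (triangle_monomial a b c k) 1 :: 'k::field mpoly)
    \<in> symbolic_power n (edge_ideal n E) (k + 2)"
proof -
  let ?R = "mpoly_ring n :: 'k mpoly ring"
  let ?I = "\<lambda>t. monomial_ideal n (packs E t) :: 'k mpoly set"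
  let ?f = "\<lambda>k. Poly_Mapping.single (triangle_monomial a b c k) 1 :: 'k mpoly"
  have V: "a \<in> {1..n}" "b \<in> {1..n}" "c \<in> {1..n}"
    using T simple_graph_edgeD[OF G] unfolding triangle_def by blast+
  then have x: "indet a \<in> carrier ?R" "indet b \<in> carrier ?R" "indet c \<in> carrier ?R"
    by (simp_all add: indet_in_carrier)
  have edge: "indet i * indet j \<in> ?I 1" if "{i, j} \<in> E" for i j
    using edge_monomial_power[OF G that, of 1] by simp
  have fk: "?f k = (indet a * indet b) ^ k * (indet a * indet b * indet c)"
  proof (induction k)
    case 0
    show ?case by (simp add: indet_def mult_single triangle_monomial_def)
  next
    case (Suc k)
    have "?f (Suc k) = (indet a * indet b) * ?f k"
      by (simp add: indet_def mult_single triangle_monomial_def single_add[symmetric] algebra_simps,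
          simp add: add.assoc[symmetric] single_add[symmetric], simp add: ac_simps)
    then show ?case unfolding Suc.IH by (simp add: mult.assoc)
  qed
  have pow: "(indet a * indet b) ^ k \<in> ?I k"
    by (rule edge_monomial_power[OF G]) (use T in \<open>simp add: triangle_def\<close>)
  have ideal: "ideal (?I t) ?R" for t by (rule ideal_monomial_ideal_packs)
  have "\<exists>s\<in>carrier ?R - P. s * ?f k \<in> ?I (k + 2)"
    if P: "P \<in> associated_primes ?R (quot_module ?R (carrier ?R) (?I 1))" for P
  proof -
    obtain g where prime: "primeideal P ?R" and g: "g \<in> carrier ?R"
      and P_eq: "P = {r \<in> carrier ?R. r * g \<in> ?I 1}"
      using P unfolding associated_primes_quot_module[OF ideal] mpoly_ring_ops by blast
    interpret P: primeideal P ?R by (rule prime)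
    have one: "(1 :: 'k mpoly) \<notin> P"
      using P.I_notcarr P.one_imp_carrier by (auto simp: mpoly_ring_ops)
    have "g \<notin> P"
    proof
      assume "g \<in> P"
      then have "g * g \<in> ?I 1" using P_eq by blast
      then have "g \<in> ?I 1" using edge_ideal_radical[OF G g] unfolding edge_ideal_eq[OF G] by blast
      then have "1 \<in> P" unfolding P_eq by (simp add: mpoly_carrier_iff)
      then show False using one by blast
    qed
    then have gg: "g * g \<in> carrier ?R - P"
      using P.I_prime[OF g g] mpoly_carrier_closed(2)[OF g g] by (auto simp: mpoly_ring_ops)
    have endpoint: "indet i * g \<in> ?I 1 \<or> indet j * g \<in> ?I 1" if e: "{i, j} \<in> E" for i j
    proof -
      have ij: "indet i \<in> carrier ?R" "indet j \<in> carrier ?R"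
        using simple_graph_edgeD[OF G e] by (simp_all add: indet_in_carrier)
      have "g * (indet i * indet j) \<in> ?I 1"
        using edge[OF e] g ideal[of 1] unfolding ideal_mpoly_ring by blast
      then have "indet i * indet j \<in> P"
        unfolding P_eq using mpoly_carrier_closed(2)[OF ij] by (simp add: mult.commute)
      then show ?thesis using P.I_prime[OF ij] unfolding mpoly_ring_ops P_eq by blast
    qed
    have two: "y * (p * g * (q * g)) \<in> ?I 2"
      if "p * g \<in> ?I 1" "q * g \<in> ?I 1" "y \<in> carrier ?R" for p q y
      using monomial_ideal_packs_mult[OF that(1,2)] that(3) ideal[of 2]
      unfolding ideal_mpoly_ring one_add_one by blast
    have "g * g * (indet a * indet b * indet c) \<in> ?I 2"
    proof -
      consider "indet a * g \<in> ?I 1" "indet b * g \<in> ?I 1" | "indet a * g \<in> ?I 1" "indet c * g \<in> ?I 1"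
        | "indet b * g \<in> ?I 1" "indet c * g \<in> ?I 1"
        using endpoint T unfolding triangle_def by blast
      then show ?thesis
      proof cases
        case 1
        then show ?thesis using two[OF 1 x(3)] by (simp only: ac_simps)
      next
        case 2
        then show ?thesis using two[OF 2 x(2)] by (simp only: ac_simps)
      next
        case 3
        then show ?thesis using two[OF 3 x(1)] by (simp only: ac_simps)
      qed
    qed
    from monomial_ideal_packs_mult[OF pow this]
    have "g * g * ?f k \<in> ?I (k + 2)" unfolding fk by (simp only: ac_simps)
    then show ?thesis using gg by blast
  qed
  moreover have "?f k \<in> carrier ?R"
    using V by (intro single_in_mpoly_carrier)
      (auto simp: triangle_monomial_def in_keys_iff lookup_add lookup_single when_def split: if_splits)
  ultimately show ?thesis
    unfolding edge_ideal_eq[OF G]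
    by (subst mem_symbolic_power_iff; unfold ideal_power_eq) (use ideal in blast)+
qed

section \<open>The primes that contain the annihilator\<close>

lemma primeideal_powerD:
  assumes "primeideal P (mpoly_ring n)" "x \<in> carrier (mpoly_ring n)" "x ^ k \<in> P"
  shows "x \<in> P"
proof -
  interpret primeideal P "mpoly_ring n" by fact
  have carr: "x ^ k \<in> carrier (mpoly_ring n)" for k
    by (induction k) (use assms(2) one_closed in \<open>auto simp: mpoly_ring_ops mpoly_carrier_closed\<close>)
  have one: "1 \<notin> P" using I_notcarr one_imp_carrier by (auto simp: mpoly_ring_ops)
  show ?thesis using assms(3)
  proof (induction k)
    case (Suc k)
    then show ?case using I_prime[OF assms(2) carr[of k]] by (auto simp: mpoly_ring_ops)
  qed (use one in simp)
qed

lemma single_power: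
  "Poly_Mapping.single (Poly_Mapping.single i k) 1 = (indet i ^ k :: 'k::comm_ring_1 mpoly)"
proof (induction k)
  case (Suc k)
  have "Poly_Mapping.single (Poly_Mapping.single i (Suc k)) 1 =
      indet i * (Poly_Mapping.single (Poly_Mapping.single i k) 1 :: 'k mpoly)"
    by (simp add: indet_def mult_single single_add[symmetric])
  then show ?case unfolding Suc.IH by simp
qed simp

lemma const_monomial_notin_prime:
  fixes P :: "'k::field mpoly set"
  assumes P: "primeideal P (mpoly_ring n)" and "finite W" "W \<subseteq> {1..n}"
    and "\<And>i. i \<in> W \<Longrightarrow> indet i \<notin> P"
  shows "Poly_Mapping.single (const_monomial W k) 1 \<notin> P"
  using assms(2-4)
proof (induction W)
  interpret primeideal P "mpoly_ring n" by (rule P)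
  case empty
  then show ?case using I_notcarr one_imp_carrier by (auto simp: const_monomial_def mpoly_ring_ops)
next
  case (insert i W)
  interpret primeideal P "mpoly_ring n" by (rule P)
  have i: "indet i \<in> carrier (mpoly_ring n :: 'k mpoly ring)" using insert.prems(1) by (simp add: indet_in_carrier)
  have eq: "Poly_Mapping.single (const_monomial (insert i W) k) 1 =
      indet i ^ k * (Poly_Mapping.single (const_monomial W k) 1 :: 'k mpoly)"
    using insert.hyps by (simp add: const_monomial_def single_power[symmetric] mult_single)
  have "indet i ^ k \<notin> P" using primeideal_powerD[OF P i] insert.prems(2) by blast
  moreover have "Poly_Mapping.single (const_monomial W k) 1 \<notin> P" using insert by blast
  moreover have "Poly_Mapping.keys (const_monomial W k) \<subseteq> {1..n}"
    using insert by (auto simp: in_keys_iff lookup_const_monomial split: if_splits)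
  then have "Poly_Mapping.single (const_monomial W k) 1 \<in> carrier (mpoly_ring n :: 'k mpoly ring)"
    by (rule single_in_mpoly_carrier)
  moreover have "indet i ^ k \<in> carrier (mpoly_ring n :: 'k mpoly ring)"
    unfolding single_power[symmetric] using insert.prems(1)
    by (intro single_in_mpoly_carrier) auto
  ultimately show ?case unfolding eq using I_prime by (auto simp: mpoly_ring_ops)
qed

lemma symbolic_power_times_const_monomial:
  fixes f :: "'k::field mpoly"
  assumes G: "simple_graph {1..n} E" and perf: "perfect_graph {1..n} E"
    and W: "W \<subseteq> {1..n}" "\<And>i j. i \<in> W \<Longrightarrow> j \<in> W \<Longrightarrow> {i, j} \<notin> E"
    and near: "\<And>a b c. triangle E a b c \<Longrightarrow> closed_nbhd E {a, b, c} \<inter> W \<noteq> {}"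
    and f: "f \<in> symbolic_power n (edge_ideal n E) t"
  shows "Poly_Mapping.single (const_monomial W t) 1 * f \<in> monomial_ideal n (packs E t)"
proof -
  have holes: "\<not> has_induced_cycle {1..n} E k" if "odd k" "k \<ge> 5" for k
    using perf that unfolding perfect_graph_def by blast
  have "finite W" using W(1) finite_subset by blast
  then have "Poly_Mapping.keys (const_monomial W t) \<subseteq> {1..n}"
    using W(1) by (auto simp: in_keys_iff lookup_const_monomial split: if_splits)
  then have "Poly_Mapping.single (const_monomial W t) 1 \<in> carrier (mpoly_ring n :: 'k mpoly ring)"
    by (rule single_in_mpoly_carrier)
  moreover have "f \<in> carrier (mpoly_ring n)" using f by (simp add: symbolic_power_def)
  ultimately have "f * Poly_Mapping.single (const_monomial W t) 1 \<in> carrier (mpoly_ring n)"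
    by (intro mpoly_carrier_closed)
  moreover have "packs E t (m + const_monomial W t)" if "m \<in> Poly_Mapping.keys f" for m
    by (intro packs_if_triangles_near_independent_set[OF G holes W near]
          symbolic_power_weight[OF G f _ that])
  ultimately show ?thesis
    by (simp add: monomial_ideal_def keys_times_monomial mult.commute)
qed

lemma edge_endpoint_in_closed_nbhd:
  "i \<in> T \<Longrightarrow> i \<in> closed_nbhd E T" "{i, j} \<in> E \<Longrightarrow> j \<in> T \<Longrightarrow> i \<in> closed_nbhd E T"
  by (auto simp: closed_nbhd_def)

text \<open>
  The right-hand side does not mention \<open>t\<close>. If the prime \<open>P\<close> contains the annihilator, the vertices
  outside \<open>P\<close> form an independent set \<open>W\<close>; if every triangle met or touched \<open>W\<close>, a power of the product
  of their variables would annihilate the module without lying in \<open>P\<close>. Conversely, an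
  annihilator \<open>f\<close> outside \<open>P\<close> has a monomial \<open>u\<close> without variables in \<open>P\<close>. Its support is independent
  and has no neighbours in the triangle, so the edges that divide the product of \<open>u\<close> with the triangle
  monomial lie in the triangle, which is impossible for reasons of degree.
\<close>

lemma prime_contains_annihilator_iff:
  fixes P :: "'k::field mpoly set"
  assumes G: "simple_graph {1..n} E" and perf: "perfect_graph {1..n} E" and "t \<ge> 2"
    and P: "primeideal P (mpoly_ring n)"
  shows "annihilator (mpoly_ring n) (quot_module (mpoly_ring n)
        (symbolic_power n (edge_ideal n E) t) (monomial_ideal n (packs E t))) \<subseteq> P \<longleftrightarrow>
      (\<forall>i j. {i, j} \<in> E \<longrightarrow> indet i \<in> P \<or> indet j \<in> P) \<and>
      (\<exists>a b c. triangle E a b c \<and> (\<forall>i\<in>closed_nbhd E {a, b, c}. indet i \<in> P))"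
    (is "?Ann \<subseteq> P \<longleftrightarrow> ?edges \<and> ?triangle")
proof -
  let ?R = "mpoly_ring n :: 'k mpoly ring"
  let ?I = "monomial_ideal n (packs E t) :: 'k mpoly set"
  let ?S = "symbolic_power n (edge_ideal n E) t :: 'k mpoly set"
  interpret primeideal P ?R by (rule P)
  have idealI: "ideal ?I ?R" by (rule ideal_monomial_ideal_packs)
  have idealP: "ideal P ?R" by (rule is_ideal)
  have S: "?S \<subseteq> carrier ?R" by (auto simp: symbolic_power_def)
  have Ann: "?Ann = {r \<in> carrier ?R. \<forall>f\<in>?S. r * f \<in> ?I}"
    using annihilator_quot_module[OF idealI S] by (simp add: mpoly_ring_ops)
  show ?thesis
  proof
    assume sub: "?Ann \<subseteq> P"
    have edges: ?edges
    proof (intro allI impI)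
      fix i j assume e: "{i, j} \<in> E"
      have ij: "indet i \<in> carrier ?R" "indet j \<in> carrier ?R"
        using simple_graph_edgeD[OF G e] by (simp_all add: indet_in_carrier)
      have pow: "(indet i * indet j) ^ t \<in> ?I" by (rule edge_monomial_power[OF G e])
      have "f * (indet i * indet j) ^ t \<in> ?I" if "f \<in> ?S" for f
        using that S idealI pow unfolding ideal_mpoly_ring by blast
      then have "(indet i * indet j) ^ t \<in> ?Ann"
        using pow unfolding Ann by (auto simp: monomial_ideal_def mult.commute)
      then have "indet i * indet j \<in> P"
        using sub primeideal_powerD[OF P mpoly_carrier_closed(2)[OF ij]] by blast
      then show "indet i \<in> P \<or> indet j \<in> P" using I_prime[OF ij] by (simp add: mpoly_ring_ops)
    qed
    have ?triangle
    proof (rule ccontr)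
      assume none: "\<not> ?triangle"
      define W where "W = {i \<in> {1..n}. indet i \<notin> P}"
      have "closed_nbhd E {a, b, c} \<inter> W \<noteq> {}" if T: "triangle E a b c" for a b c
      proof -
        obtain i where i: "i \<in> closed_nbhd E {a, b, c}" "indet i \<notin> P" using none T by blast
        then have "i \<in> {1..n}"
          using T simple_graph_edgeD[OF G] unfolding triangle_def closed_nbhd_def by blast
        then show ?thesis using i unfolding W_def by blast
      qed
      moreover have "{i, j} \<notin> E" if "i \<in> W" "j \<in> W" for i j
        using edges that unfolding W_def by blast
      moreover have W: "W \<subseteq> {1..n}" "finite W" by (auto simp: W_def)
      ultimately have "Poly_Mapping.single (const_monomial W t) 1 * f \<in> ?I" if "f \<in> ?S" for f
        using symbolic_power_times_const_monomial[OF G perf _ _ _ that] by blast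
      moreover have "Poly_Mapping.keys (const_monomial W t) \<subseteq> {1..n}"
        using W by (auto simp: in_keys_iff lookup_const_monomial split: if_splits)
      then have "Poly_Mapping.single (const_monomial W t) 1 \<in> carrier ?R"
        by (rule single_in_mpoly_carrier)
      ultimately have "Poly_Mapping.single (const_monomial W t) 1 \<in> P" using sub Ann by blast
      then show False
        using const_monomial_notin_prime[OF P W(2,1)] unfolding W_def by blast
    qed
    with edges show "?edges \<and> ?triangle" ..
  next
    assume "?edges \<and> ?triangle"
    then obtain a b c where edges: ?edges and T: "triangle E a b c"
      and nbhd: "\<And>i. i \<in> closed_nbhd E {a, b, c} \<Longrightarrow> indet i \<in> P" by blast
    show "?Ann \<subseteq> P"
    proof (rule subsetI, rule ccontr)
      fix f assume f: "f \<in> ?Ann" and "f \<notin> P"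
      have fc: "f \<in> carrier ?R" using f Ann by blast
      obtain u where u: "u \<in> Poly_Mapping.keys f" "\<And>i. expo u i > 0 \<Longrightarrow> indet i \<notin> P"
      proof -
        have "\<exists>u\<in>Poly_Mapping.keys f. Poly_Mapping.single u (expo f u) \<notin> P"
          using ideal_memI_monomials[OF idealP, of f] \<open>f \<notin> P\<close> by blast
        then obtain u where u: "u \<in> Poly_Mapping.keys f" "Poly_Mapping.single u (expo f u) \<notin> P" by blast
        have "indet i \<notin> P" if i: "expo u i > 0" for i
        proof
          assume "indet i \<in> P"
          have "u = (u - Poly_Mapping.single i 1) + Poly_Mapping.single i 1"
            by (rule poly_mapping_eqI) (use i in \<open>auto simp: lookup_add lookup_minus lookup_single when_def\<close>)
          then have "Poly_Mapping.single u (expo f u) =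
              Poly_Mapping.single (u - Poly_Mapping.single i 1) (expo f u) * indet i"
            by (simp add: indet_def mult_single)
          moreover have "Poly_Mapping.keys (u - Poly_Mapping.single i 1) \<subseteq> Poly_Mapping.keys u"
            by (auto simp: in_keys_iff lookup_minus)
          then have "Poly_Mapping.single (u - Poly_Mapping.single i 1) (expo f u) \<in> carrier ?R"
            using fc u(1) by (intro single_in_mpoly_carrier) (auto simp: mpoly_carrier_iff)
          ultimately have "Poly_Mapping.single u (expo f u) \<in> P"
            using \<open>indet i \<in> P\<close> idealP unfolding ideal_mpoly_ring by simp
          then show False using u(2) by blast
        qed
        then show ?thesis using that u(1) by blast
      qed
      define m where "m = triangle_monomial a b c (t - 2)"
      have t: "t - 2 + 2 = t" using \<open>t \<ge> 2\<close> by simp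
      have "(Poly_Mapping.single m 1 :: 'k mpoly) \<in> ?S"
        using triangle_monomial_symbolic[OF G T, of "t - 2"] unfolding m_def t .
      then have "f * Poly_Mapping.single m 1 \<in> ?I" using f unfolding Ann by blast
      then have packs: "packs E t (u + m)"
        using u(1) by (auto simp: monomial_ideal_def keys_times_monomial)
      have m_out: "expo m i = 0" if "i \<notin> {a, b, c}" for i
        using that by (simp add: m_def triangle_monomial_def lookup_add lookup_single when_def)
      have key: "i \<in> {a, b, c}" if e: "{i, j} \<in> E" "expo (u + m) i > 0" "expo (u + m) j > 0" for i j
      proof (rule ccontr)
        assume "i \<notin> {a, b, c}"
        then have "indet i \<notin> P" using e(2) m_out u(2) by (simp add: lookup_add)
        then have "indet j \<in> P" using edges e(1) by blast
        then have "expo u j = 0" using u(2) by blast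
        then have j: "j \<in> {a, b, c}" using e(3) m_out[of j] unfolding lookup_add by linarith
        show False using nbhd[OF edge_endpoint_in_closed_nbhd(2)[OF e(1) j]] \<open>indet i \<notin> P\<close> by blast
      qed
      have "i \<in> {a, b, c} \<and> j \<in> {a, b, c}"
        if "{i, j} \<in> E" "expo (u + m) i > 0" "expo (u + m) j > 0" for i j
        using key[of i j] key[of j i] that by (simp add: insert_commute)
      then have "2 * t \<le> weight {a, b, c} (u + m)"
        by (intro packs_within[OF _ _ packs]) simp_all
      moreover have "weight {a, b, c} u = 0"
      proof (rule sum.neutral, rule ballI)
        fix i assume "i \<in> {a, b, c}"
        then show "expo u i = 0" using nbhd[OF edge_endpoint_in_closed_nbhd(1)] u(2) by blast
      qed
      moreover have "weight {a, b, c} m = 2 * (t - 2) + 3"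
        unfolding m_def by (rule weight_triangle_monomial)
      ultimately show False unfolding weight_add using \<open>t \<ge> 2\<close> by linarith
    qed
  qed
qed

lemma symbolic_power_triangle_free:
  assumes "simple_graph {1..n} E" "perfect_graph {1..n} E" "\<And>a b c. \<not> triangle E a b c"
  shows "(symbolic_power n (edge_ideal n E) t :: 'k::field mpoly set) \<subseteq> monomial_ideal n (packs E t)"
proof
  fix f :: "'k mpoly" assume f: "f \<in> symbolic_power n (edge_ideal n E) t"
  have "Poly_Mapping.single (const_monomial {} t) 1 * f \<in> monomial_ideal n (packs E t)"
    by (rule symbolic_power_times_const_monomial[OF assms(1,2) _ _ _ f]) (use assms(3) in auto)
  then show "f \<in> monomial_ideal n (packs E t)" by (simp add: const_monomial_def)
qed

lemma symbolic_power_not_subset: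
  assumes G: "simple_graph {1..n} E" and T: "triangle E a b c" and "t \<ge> 2"
  shows "\<not> (symbolic_power n (edge_ideal n E) t :: 'k::field mpoly set) \<subseteq> monomial_ideal n (packs E t)"
proof
  define m where "m = triangle_monomial a b c (t - 2)"
  have t: "t - 2 + 2 = t" using \<open>t \<ge> 2\<close> by simp
  assume "(symbolic_power n (edge_ideal n E) t :: 'k mpoly set) \<subseteq> monomial_ideal n (packs E t)"
  then have "(Poly_Mapping.single m 1 :: 'k mpoly) \<in> monomial_ideal n (packs E t)"
    using triangle_monomial_symbolic[OF G T, of "t - 2", where 'k='k] unfolding m_def t by blast
  then have "packs E t m" by (simp add: monomial_ideal_def)
  moreover have "i \<in> {a, b, c}" if "expo m i > 0" for i
    using that by (auto simp: m_def triangle_monomial_def lookup_add lookup_single when_def split: if_splits)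
  ultimately have "2 * t \<le> weight {a, b, c} m"
    by (intro packs_within) auto
  then show False unfolding m_def weight_triangle_monomial using \<open>t \<ge> 2\<close> by linarith
qed

lemma zero_in_symbolic_power:
  assumes "simple_graph {1..n} E"
  shows "0 \<in> (symbolic_power n (edge_ideal n E) t :: 'k::field mpoly set)"
proof -
  have I: "ideal (ideal_power (mpoly_ring n) (edge_ideal n E :: 'k mpoly set) t) (mpoly_ring n)"
    unfolding ideal_power_edge_ideal[OF assms] by (rule ideal_monomial_ideal_packs)
  show ?thesis
    unfolding mem_symbolic_power_iff[OF I]
  proof (intro conjI ballI)
    show "(0 :: 'k mpoly) \<in> carrier (mpoly_ring n)" by (simp add: mpoly_carrier_iff)
    fix P :: "'k mpoly set"
    assume "P \<in> associated_primes (mpoly_ring n)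
      (quot_module (mpoly_ring n) (carrier (mpoly_ring n)) (edge_ideal n E))"
    then interpret primeideal P "mpoly_ring n" by (simp add: associated_primes_def)
    have "1 \<in> carrier (mpoly_ring n) - P"
      using I_notcarr one_imp_carrier by (auto simp: mpoly_ring_ops mpoly_carrier_iff)
    then show "\<exists>s\<in>carrier (mpoly_ring n) - P. s * 0 \<in> ideal_power (mpoly_ring n) (edge_ideal n E) t"
      using I by (auto simp: ideal_mpoly_ring)
  qed
qed

theorem theorem7p11:
  fixes n t :: nat and E :: "nat set set" and I :: "'k::field mpoly set"
  assumes "simple_graph {1..n} E" and "connected_graph {1..n} E"
    and "perfect_graph {1..n} E"
    and "I = edge_ideal n E"
    and "t \<ge> 2"
  shows "module_dim (mpoly_ring n)
           (quot_module (mpoly_ring n) (symbolic_power n I t) (ideal_power (mpoly_ring n) I t)) =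
         module_dim (mpoly_ring n)
           (quot_module (mpoly_ring n) (symbolic_power n I 2) (ideal_power (mpoly_ring n) I 2))"
proof -
  let ?R = "mpoly_ring n :: 'k mpoly ring"
  let ?S = "\<lambda>t. symbolic_power n (edge_ideal n E) t :: 'k mpoly set"
  let ?I = "\<lambda>t. monomial_ideal n (packs E t) :: 'k mpoly set"
  let ?M = "\<lambda>t. quot_module ?R (?S t) (?I t)"
  note G = assms(1) and perf = assms(3)
  have ideal: "ideal (?I t) ?R" for t by (rule ideal_monomial_ideal_packs)
  have S: "?S t \<subseteq> carrier ?R" "?S t \<noteq> {}" for t
    using zero_in_symbolic_power[OF G, of t, where 'k='k] by (auto simp: symbolic_power_def)
  note trivial_iff = quot_module_trivial_iff[OF ideal S]
  have "module_dim ?R (?M t) = module_dim ?R (?M 2)"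
  proof (cases "\<exists>a b c. triangle E a b c")
    case True
    have nontrivial: "\<not> ?S t \<subseteq> ?I t" if "t \<ge> 2" for t
      using True symbolic_power_not_subset[OF G _ that] by blast
    have "krull_dim (?R Quot annihilator ?R (?M t)) = krull_dim (?R Quot annihilator ?R (?M 2))"
      by (intro krull_dim_quot_cong cring_mpoly_ring ideal_annihilator_quot_module ideal S(1))
         (simp add: prime_contains_annihilator_iff[OF G perf] \<open>t \<ge> 2\<close>)
    then show ?thesis
      unfolding module_dim_def trivial_iff using nontrivial \<open>t \<ge> 2\<close> by simp
  next
    case False
    then have "?S t \<subseteq> ?I t" for t using symbolic_power_triangle_free[OF G perf] by blast
    then show ?thesis unfolding module_dim_def trivial_iff by simp
  qed
  then show ?thesis unfolding assms(4) ideal_power_edge_ideal[OF G] .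
qed

end
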